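(* For any loopless matroid $\mathsf{M}$ on $E=[n]$, the function $g_{\mathsf{M}}^{\mathbb{D}}:\Sigma_{\mathsf{M}}\to\mathbb{Z}[y]$ defined by $$g_{\mathsf{M}}^{\mathbb{D}}(\mathcal{F})=\frac{\chi_{\mathsf{M}}(-y)[\mathcal{F}]}{-1-y}$$ is a Grothendieck weight on $\Sigma_{\mathsf{M}}$.
   Context: $[n]=\{1,\dots,n\}$, $n\ge1$. A flag of flats of $\mathsf{M}$ is a (possibly empty) chain $\mathcal{F}:\emptyset\subsetneq F_1\subsetneq\cdots\subsetneq F_k\subsetneq E$ of nonempty proper flats. The cones of the matroidal fan $\Sigma_{\mathsf{M}}$ are indexed by flags of flats, and $\Sigma_{\mathsf{M}}$ is identified with the set of flags of flats. The characteristic polynomial of a matroid is $\chi_{\mathsf{M}}(t)=\sum_F\mu(\emptyset,F)t^{\operatorname{rk}\mathsf{M}-\operatorname{rk}F}$ (sum over flats), and $\chi_{\mathsf{M}}(t)[\mathcal{F}]:=\chi_{\mathsf{M}|F_1}(t)\,\chi_{\mathsf{M}|F_2/F_1}(t)\cdots\chi_{\mathsf{M}/F_k}(t)$ (for the empty flag it is $\chi_{\mathsf{M}}(t)$). Each factor is divisible by $t-1$, so the quotient above lies in $\mathbb{Z}[y]$. The matroid $K$-ring $K(\mathsf{M})$ is the commutative ring generated by symbols $x_F$, $F$ a nonempty proper flat, subject to: $x_Fx_G=0$ if $F,G$ are incomparable; and $\prod_{F\not\ni i}(1-x_F)=\prod_{F\not\ni j}(1-x_F)$ for all $i,j\in E$.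 For a flag of flats put $x_{\mathcal{F}}=x_{F_1}\cdots x_{F_k}$, $x_\emptyset=1$. A ($\mathbb{Z}[y]$-valued) Grothendieck weight on $\Sigma_{\mathsf{M}}$ is a function $g:\Sigma_{\mathsf{M}}\to\mathbb{Z}[y]$ such that $\sum_{\mathcal{F}}c_{\mathcal{F}}g(\mathcal{F})=0$ for every relation $\sum_{\mathcal{F}}c_{\mathcal{F}}x_{\mathcal{F}}=0$ in $K(\mathsf{M})$ with $c_{\mathcal{F}}\in\mathbb{Z}$. *)

theory Defs
  imports
    "HOL-Algebra.QuotRing"
    "HOL-Computational_Algebra.Polynomial"
    "HOL-Library.Poly_Mapping"
begin

section \<open>Matroids\<close>

record 'a set_system =
  ground :: "'a set"
  indeps :: "'a set set"

locale matroid =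
  fixes M :: "'a set_system"
  assumes finite_ground: "finite (ground M)"
    and indeps_subset: "indeps M \<subseteq> Pow (ground M)"
    and empty_indep: "{} \<in> indeps M"
    and indep_mono: "\<And>I J. J \<in> indeps M \<Longrightarrow> I \<subseteq> J \<Longrightarrow> I \<in> indeps M"
    and augment: "\<And>I J. I \<in> indeps M \<Longrightarrow> J \<in> indeps M \<Longrightarrow> card I < card J \<Longrightarrow>
                    \<exists>e\<in>J - I. insert e I \<in> indeps M"

definition loopless :: "'a set_system \<Rightarrow> bool" where
  "loopless M \<longleftrightarrow> (\<forall>e\<in>ground M. {e} \<in> indeps M)"

definition rank :: "'a set_system \<Rightarrow> 'a set \<Rightarrow> nat" where
  "rank M A = Max (card ` {I \<in> indeps M. I \<subseteq> A})"

definition flats :: "'a set_system \<Rightarrow> 'a set set" where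
  "flats M = {F. F \<subseteq> ground M \<and> (\<forall>e\<in>ground M - F. rank M F < rank M (insert e F))}"

definition proper_flats :: "'a set_system \<Rightarrow> 'a set set" where
  "proper_flats M = {F \<in> flats M. F \<noteq> {} \<and> F \<noteq> ground M}"

definition basis_of :: "'a set_system \<Rightarrow> 'a set \<Rightarrow> 'a set \<Rightarrow> bool" where
  "basis_of M A B \<longleftrightarrow> B \<in> indeps M \<and> B \<subseteq> A \<and> (\<forall>e\<in>A - B. insert e B \<notin> indeps M)"

definition restrict_matroid :: "'a set_system \<Rightarrow> 'a set \<Rightarrow> 'a set_system" where
  "restrict_matroid M A = \<lparr>ground = A, indeps = {I \<in> indeps M. I \<subseteq> A}\<rparr>"

definition contract_matroid :: "'a set_system \<Rightarrow> 'a set \<Rightarrow> 'a set_system" where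
  "contract_matroid M A =
     \<lparr>ground = ground M - A,
      indeps = {I. I \<subseteq> ground M - A \<and> (\<exists>B. basis_of M A B \<and> I \<union> B \<in> indeps M)}\<rparr>"

section \<open>Characteristic polynomials\<close>

text \<open>
  Moebius function of a family \<open>P\<close> of sets ordered by inclusion. It is meant for
  \<open>F, G \<in> P\<close>; the guard \<open>finite G\<close> only serves termination.
\<close>

function mobius :: "'a set set \<Rightarrow> 'a set \<Rightarrow> 'a set \<Rightarrow> int" where
  "mobius P F G =
     (if F = G then 1
      else if finite G \<and> F \<subset> G then - (\<Sum>H\<in>{H \<in> P. F \<subseteq> H \<and> H \<subset> G}. mobius P F H)
      else 0)"
  by pat_completeness auto
termination
  by (relation "Wellfounded.measure (\<lambda>(P, F, G). card G)") (auto intro: psubset_card_mono)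

declare mobius.simps [simp del]

definition char_poly :: "'a set_system \<Rightarrow> int poly" where
  "char_poly M =
     (\<Sum>F\<in>flats M. monom (mobius (flats M) {} F) (rank M (ground M) - rank M F))"

text \<open>
  A flag \<open>F\<^sub>1 \<subset> \<dots> \<subset> F\<^sub>k\<close> is the list \<open>[F\<^sub>1, \<dots>, F\<^sub>k]\<close>; the cones
  of the fan of \<open>M\<close> are identified with these lists.
\<close>

definition flags :: "'a set_system \<Rightarrow> 'a set list set" where
  "flags M = {fs. set fs \<subseteq> proper_flats M \<and> sorted_wrt (\<subset>) fs}"

text \<open>
  The factors range over consecutive pairs of \<open>{} \<subset> F\<^sub>1 \<subset> \<dots> \<subset> F\<^sub>k \<subset> E\<close>. The end
  factors are the required ones because \<open>M/{} = M\<close> and \<open>M|E = M\<close>.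
\<close>

definition char_poly_flag :: "'a set_system \<Rightarrow> 'a set list \<Rightarrow> int poly" where
  "char_poly_flag M fs =
     prod_list (map2 (\<lambda>F G. char_poly (contract_matroid (restrict_matroid M G) F))
                  ({} # fs) (fs @ [ground M]))"

text \<open>
  Here \<open>[:0, -1:]\<close> is \<open>-y\<close> and \<open>[:-1, -1:]\<close> is \<open>-1 - y\<close>. The division is exact for
  every flag of a matroid with nonempty ground set, see \<open>gD_times\<close> below.
\<close>

definition gD :: "'a set_system \<Rightarrow> 'a set list \<Rightarrow> int poly" where
  "gD M fs = pcompose (char_poly_flag M fs) [:0, -1:] div [:-1, -1:]"

section \<open>The matroid K-ring\<close>

text \<open>
  The polynomial ring over the integers in variables indexed by \<open>V\<close>: a monomial is a
  finitely supported exponent map, a polynomial a finitely supported map from monomials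
  to coefficients.
\<close>

definition mpoly_ring :: "'v set \<Rightarrow> (('v \<Rightarrow>\<^sub>0 nat) \<Rightarrow>\<^sub>0 int) ring" where
  "mpoly_ring V =
     \<lparr>carrier = {p. \<forall>m\<in>Poly_Mapping.keys p. Poly_Mapping.keys m \<subseteq> V},
      monoid.mult = (*), one = 1, zero = 0, add = (+)\<rparr>"

definition mvar :: "'v \<Rightarrow> (('v \<Rightarrow>\<^sub>0 nat) \<Rightarrow>\<^sub>0 int)" where
  "mvar v = Poly_Mapping.single (Poly_Mapping.single v 1) 1"

definition K_relations :: "'a set_system \<Rightarrow> (('a set \<Rightarrow>\<^sub>0 nat) \<Rightarrow>\<^sub>0 int) set" where
  "K_relations M =
     {mvar F * mvar G | F G.
        F \<in> proper_flats M \<and> G \<in> proper_flats M \<and> \<not> F \<subseteq> G \<and> \<not> G \<subseteq> F} \<union>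
     {(\<Prod>F\<in>{F \<in> proper_flats M. i \<notin> F}. 1 - mvar F) -
      (\<Prod>F\<in>{F \<in> proper_flats M. j \<notin> F}. 1 - mvar F) | i j.
        i \<in> ground M \<and> j \<in> ground M}"

definition K_ideal :: "'a set_system \<Rightarrow> (('a set \<Rightarrow>\<^sub>0 nat) \<Rightarrow>\<^sub>0 int) set" where
  "K_ideal M = genideal (mpoly_ring (proper_flats M)) (K_relations M)"

definition K_ring :: "'a set_system \<Rightarrow> (('a set \<Rightarrow>\<^sub>0 nat) \<Rightarrow>\<^sub>0 int) set ring" where
  "K_ring M = mpoly_ring (proper_flats M) Quot K_ideal M"

definition K_var :: "'a set_system \<Rightarrow> 'a set \<Rightarrow> (('a set \<Rightarrow>\<^sub>0 nat) \<Rightarrow>\<^sub>0 int) set" where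
  "K_var M F = K_ideal M +>\<^bsub>mpoly_ring (proper_flats M)\<^esub> mvar F"

definition K_monomial :: "'a set_system \<Rightarrow> 'a set list \<Rightarrow> (('a set \<Rightarrow>\<^sub>0 nat) \<Rightarrow>\<^sub>0 int) set" where
  "K_monomial M fs = (\<Otimes>\<^bsub>K_ring M\<^esub>F\<in>set fs. K_var M F)"

definition grothendieck_weight :: "'a set_system \<Rightarrow> ('a set list \<Rightarrow> int poly) \<Rightarrow> bool" where
  "grothendieck_weight M g \<longleftrightarrow>
     (\<forall>c :: 'a set list \<Rightarrow> int.
        (\<Oplus>\<^bsub>K_ring M\<^esub>fs\<in>flags M. [c fs] \<cdot>\<^bsub>K_ring M\<^esub> K_monomial M fs) = \<zero>\<^bsub>K_ring M\<^esub> \<longrightarrow>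
        (\<Sum>fs\<in>flags M. of_int (c fs) * g fs) = 0)"

section \<open>Well-definedness\<close>

lemma cring_mpoly_ring: "cring (mpoly_ring V)"
proof -
  let ?C = "carrier (mpoly_ring V)"
  have C: "?C = {p. \<forall>m\<in>Poly_Mapping.keys p. Poly_Mapping.keys m \<subseteq> V}"
    by (simp add: mpoly_ring_def)
  have add: "p + q \<in> ?C" if "p \<in> ?C" "q \<in> ?C" for p q
    using that keys_add[of p q] unfolding C by blast
  have mult: "p * q \<in> ?C" if "p \<in> ?C" "q \<in> ?C" for p q
  proof -
    have "Poly_Mapping.keys m \<subseteq> V" if m: "m \<in> Poly_Mapping.keys (p * q)" for m
    proof -
      obtain a b where "m = a + b" "a \<in> Poly_Mapping.keys p" "b \<in> Poly_Mapping.keys q"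
        using subsetD[OF keys_mult m] by blast
      then show ?thesis
        using \<open>p \<in> ?C\<close> \<open>q \<in> ?C\<close> order_trans[OF keys_add[of a b]] unfolding C
        by simp
    qed
    then show ?thesis unfolding C by blast
  qed
  have neg: "- p \<in> ?C" if "p \<in> ?C" for p
    using that unfolding C by simp
  have ops: "p \<oplus>\<^bsub>mpoly_ring V\<^esub> q = p + q" "p \<otimes>\<^bsub>mpoly_ring V\<^esub> q = p * q"
    "\<zero>\<^bsub>mpoly_ring V\<^esub> = 0" "\<one>\<^bsub>mpoly_ring V\<^esub> = 1" for p q
    by (simp_all add: mpoly_ring_def)
  have zero: "0 \<in> ?C" and one: "1 \<in> ?C"
    unfolding C by simp_all
  have "abelian_group (mpoly_ring V)"
  proof (rule abelian_groupI)
    fix p assume "p \<in> ?C"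
    then show "\<exists>q\<in>?C. q \<oplus>\<^bsub>mpoly_ring V\<^esub> p = \<zero>\<^bsub>mpoly_ring V\<^esub>"
      by (intro bexI[OF _ neg]) (simp_all add: ops)
  qed (simp_all add: ops add zero add.assoc add.commute)
  moreover have "Group.comm_monoid (mpoly_ring V)"
    by (rule comm_monoidI) (simp_all add: ops mult one mult.assoc mult.commute)
  ultimately show ?thesis
    by (rule cringI) (simp add: ops distrib_right)
qed

lemma mvar_in_carrier: "v \<in> V \<Longrightarrow> mvar v \<in> carrier (mpoly_ring V)"
  by (auto simp: mvar_def mpoly_ring_def split: if_splits)

lemma K_relations_subset: "K_relations M \<subseteq> carrier (mpoly_ring (proper_flats M))"
proof -
  define R where "R = mpoly_ring (proper_flats M)"
  interpret cring R unfolding R_def by (rule cring_mpoly_ring)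
  have ops: "a \<oplus>\<^bsub>R\<^esub> b = a + b" "a \<otimes>\<^bsub>R\<^esub> b = a * b" "\<one>\<^bsub>R\<^esub> = 1" for a b
    by (simp_all add: R_def mpoly_ring_def)
  have neg: "- a \<in> carrier R" if "a \<in> carrier R" for a
    using that by (simp add: R_def mpoly_ring_def)
  have minus: "a - b \<in> carrier R" if "a \<in> carrier R" "b \<in> carrier R" for a b
    using add.m_closed[OF that(1) neg[OF that(2)]] by (simp add: ops)
  have factor: "1 - mvar F \<in> carrier R" if "F \<in> proper_flats M" for F
    using minus[of 1 "mvar F"] one_closed mvar_in_carrier[OF that, folded R_def]
    by (simp only: ops)
  have prod: "(\<Prod>F\<in>A. 1 - mvar F) \<in> carrier R" if "A \<subseteq> proper_flats M" for A
    using that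
  proof (induction A rule: infinite_finite_induct)
    case (insert F A)
    then show ?case using m_closed[OF factor[of F]] by (simp add: ops)
  qed (use one_closed in \<open>auto simp: ops\<close>)
  have mult: "mvar F * mvar G \<in> carrier R" if "F \<in> proper_flats M" "G \<in> proper_flats M" for F G
    using m_closed[OF mvar_in_carrier[OF that(1), folded R_def]
        mvar_in_carrier[OF that(2), folded R_def]]
    by (simp only: ops)
  show ?thesis
    unfolding K_relations_def R_def[symmetric] by (auto intro!: minus prod mult)
qed

lemma ideal_K_ideal: "ideal (K_ideal M) (mpoly_ring (proper_flats M))"
  unfolding K_ideal_def
  by (intro ring.genideal_ideal cring.axioms(1) cring_mpoly_ring K_relations_subset)

lemma cring_K_ring: "cring (K_ring M)"
  unfolding K_ring_def by (rule ideal.quotient_is_cring[OF ideal_K_ideal cring_mpoly_ring])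

lemma K_var_in_carrier: "F \<in> proper_flats M \<Longrightarrow> K_var M F \<in> carrier (K_ring M)"
  unfolding K_var_def K_ring_def FactRing_def A_RCOSETS_def'
  using mvar_in_carrier[of F "proper_flats M"] by (simp only: partial_object.simps) blast

lemma K_monomial_in_carrier: "fs \<in> flags M \<Longrightarrow> K_monomial M fs \<in> carrier (K_ring M)"
  unfolding K_monomial_def flags_def
  by (intro comm_monoid.finprod_closed cring.axioms(2) cring_K_ring) (auto intro: K_var_in_carrier)

lemma finite_flags:
  assumes "finite (ground M)"
  shows "finite (flags M)"
proof (rule finite_subset)
  have "finite (proper_flats M)"
    by (rule finite_subset[of _ "Pow (ground M)"])
       (auto simp: proper_flats_def flats_def assms)
  then show "finite {fs. set fs \<subseteq> proper_flats M \<and> distinct fs}"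
    by (rule finite_subset_distinct)
  have "distinct fs" if "sorted_wrt (\<subset>) fs" for fs :: "'a set list"
    using that by (induction fs) auto
  then show "flags M \<subseteq> {fs. set fs \<subseteq> proper_flats M \<and> distinct fs}"
    by (auto simp: flags_def)
qed

lemma poly_char_poly_one:
  assumes "finite (ground M)" "ground M \<noteq> {}"
  shows "poly (char_poly M) 1 = 0"
proof -
  let ?E = "ground M" and ?\<mu> = "mobius (flats M) {}"
  have sub: "flats M \<subseteq> Pow ?E" by (auto simp: flats_def)
  have fin: "finite (flats M)" using sub assms(1) by (simp add: finite_subset)
  have E: "?E \<in> flats M" by (simp add: flats_def)
  have "poly (char_poly M) 1 = (\<Sum>F\<in>flats M. ?\<mu> F)"
    by (simp add: char_poly_def poly_sum poly_monom)
  also have "\<dots> = ?\<mu> ?E + (\<Sum>F\<in>flats M - {?E}. ?\<mu> F)"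
    using fin E by (rule sum.remove)
  also have "flats M - {?E} = {H \<in> flats M. {} \<subseteq> H \<and> H \<subset> ?E}"
    using sub by auto
  also have "?\<mu> ?E + (\<Sum>F\<in>\<dots>. ?\<mu> F) = 0"
    using assms mobius.simps[of "flats M" "{}" "ground M"] by (simp add: psubset_eq)
  finally show ?thesis .
qed

lemma gD_times:
  assumes "matroid M" "ground M \<noteq> {}" "fs \<in> flags M"
  shows "gD M fs * [:-1, -1:] = pcompose (char_poly_flag M fs) [:0, -1:]"
proof -
  let ?G = "hd (fs @ [ground M])"
  let ?N = "contract_matroid (restrict_matroid M ?G) {}"
  have G: "?G \<noteq> {}" "?G \<subseteq> ground M"
    using assms by (cases fs; auto simp: flags_def proper_flats_def flats_def)+
  have "ground ?N = ?G" by (simp add: contract_matroid_def restrict_matroid_def)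
  moreover have "finite ?G"
    using G(2) matroid.finite_ground[OF assms(1)] by (rule finite_subset)
  ultimately have "poly (char_poly ?N) 1 = 0"
    using G(1) by (intro poly_char_poly_one) auto
  then have "poly (char_poly_flag M fs) 1 = 0"
    by (cases fs) (auto simp: char_poly_flag_def)
  then have "poly (pcompose (char_poly_flag M fs) [:0, -1:]) (-1) = 0"
    by (simp add: poly_pcompose)
  then have "[:1, 1:] dvd pcompose (char_poly_flag M fs) [:0, -1:]"
    by (simp add: poly_eq_0_iff_dvd)
  moreover have "[:-1, -1:] = - ([:1, 1:] :: int poly)"
    by simp
  ultimately have "[:-1, -1:] dvd pcompose (char_poly_flag M fs) [:0, -1:]"
    by (simp only: minus_dvd_iff)
  then show ?thesis unfolding gD_def by (rule dvd_div_mult_self)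
qed

end

(*
  A function m |-> f m on exponent vectors (one integer for each flat) is the same as a functional on
  Laurent polynomials in the elements 1 - x_F: multiplication by x_F becomes a difference operator.
  For every pair of flats F < G such a function is constructed for the minor M|G/F, by induction on
  the interval. Its differences are prescribed by the functions of the two smaller minors M|H/F and
  M|G/H, and they fit together because the two ways of restricting along a flag F < K < H < G agree;
  hence the function exists by a discrete Poincare lemma, with the reduced characteristic polynomial
  as its value at 0. The relations between incomparable flats hold by construction. The other
  relations say that shifting by the indicator of {F. i not in F} does not depend on i; as the
  differences of the two shifted functions agree, it suffices to compare them at 0, where Weisner's
  theorem gives the common value. On a flag, evaluating the iterated differences at 0 returns the
  product of characteristic polynomials.
*)
theory Submission
  imports Defs
begin

section \<open>Characteristic polynomials of intervals\<close>

text \<open>Write q = -y. Flags only see squarefree monomials, but the ideal of relations also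
  contains monomials with repeated variables, so a value must be found for those too. On the star of
  H, the linear relation for i in H and j not in H says that 1 - x_H is the product of (1 -
  x_K)^(-1) over the K below H containing i and the K above H avoiding j. This determines the powers
  of x_H, and its negative exponents are the reason for integer exponent vectors. A flag of length k
  has k + 1 characteristic polynomials, each divisible by q - 1, and only one such factor is divided
  out. Hence every multiplication by a variable contributes \<open>qvar1\<close> = q - 1. The common
  value t(F,G) of the shifts by {K. i not in K} is forced: switching on the flats avoiding i one at
  a time requires the reduced polynomial of [F,G] to be the sum over H avoiding i of chi(F,H)
  t(H,G). Solving this gives q^(r-1) times the reduced polynomial at q = 1, where r is the rank of
  the minor; up to sign that number is Crapo's beta invariant, so i has disappeared.\<close>

abbreviation qvar :: "int poly" where "qvar \<equiv> [:0, -1:]"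
abbreviation qvar1 :: "int poly" where "qvar1 \<equiv> [:-1, -1:]"

text \<open>The construction sees the matroid only through these properties of its flats. Minors are
  treated as intervals of one fixed family \<open>L\<close>, so the induction over minors never
  forms a new matroid. The flat \<open>K\<close> in \<open>join\<close> is the closure of
  \<open>insert e F\<close>.\<close>

locale ranked_flats =
  fixes L :: "'a set set" and \<rho> :: "'a set \<Rightarrow> nat"
  assumes finite_L: "finite L"
    and finite_flat: "F \<in> L \<Longrightarrow> finite F"
    and rank_strict: "F \<in> L \<Longrightarrow> G \<in> L \<Longrightarrow> F \<subset> G \<Longrightarrow> \<rho> F < \<rho> G"
    and join: "F \<in> L \<Longrightarrow> G \<in> L \<Longrightarrow> F \<subseteq> G \<Longrightarrow> e \<in> G - F \<Longrightarrow>
      \<exists>K\<in>L. insert e F \<subseteq> K \<and> \<rho> K = Suc (\<rho> F) \<and> (\<forall>H\<in>L. insert e F \<subseteq> H \<longrightarrow> K \<subseteq> H)"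
begin

definition interval :: "'a set \<Rightarrow> 'a set \<Rightarrow> 'a set set" where
  "interval F G = {H \<in> L. F \<subseteq> H \<and> H \<subseteq> G}"

text \<open>This is the characteristic polynomial of the minor on [F, G] evaluated at -y; see
  \<open>pcompose_char_poly_minor\<close>.\<close>

definition chi :: "'a set \<Rightarrow> 'a set \<Rightarrow> int poly" where
  "chi F G = (\<Sum>H\<in>interval F G. of_int (mobius L F H) * qvar ^ (\<rho> G - \<rho> H))"

definition rchi :: "'a set \<Rightarrow> 'a set \<Rightarrow> int poly" where
  "rchi F G = chi F G div qvar1"

text \<open>
  This is the value that \<open>\<Prod>\<^bsub>e \<notin> H\<^esub> (1 - x\<^sub>H)\<close> must take. It is obtained by inverting \<open>chi\<close> in the
  incidence algebra of the flats avoiding \<open>e\<close>; the point is that it does not depend on \<open>e\<close>.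
\<close>

definition twist :: "'a set \<Rightarrow> 'a set \<Rightarrow> int poly" where
  "twist F G = qvar ^ (\<rho> G - Suc (\<rho> F)) * of_int (poly (rchi F G) (-1))"

lemma finite_interval [simp]: "finite (interval F G)"
  using finite_L by (simp add: interval_def)

lemma rank_mono: "F \<in> L \<Longrightarrow> G \<in> L \<Longrightarrow> F \<subseteq> G \<Longrightarrow> \<rho> F \<le> \<rho> G"
  using rank_strict[of F G] by (cases "F = G") (auto simp: psubset_eq)

lemma mobius_refl [simp]: "mobius L F F = 1"
  by (subst mobius.simps) simp

section \<open>Moebius inversion and Weisner's theorem on intervals of flats\<close>

lemma sum_mobius_upper:
  assumes "F \<in> L" "G \<in> L" "F \<subseteq> G"
  shows "(\<Sum>H\<in>interval F G. mobius L F H) = (if F = G then 1 else 0)"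
proof (cases "F = G")
  case True
  with assms have "interval F G = {F}" by (auto simp: interval_def)
  with True show ?thesis by simp
next
  case False
  have eq: "interval F G = insert G {H \<in> L. F \<subseteq> H \<and> H \<subset> G}"
    using assms by (auto simp: interval_def)
  have fin: "finite {H \<in> L. F \<subseteq> H \<and> H \<subset> G}" using finite_L by simp
  have "mobius L F G = - (\<Sum>H\<in>{H \<in> L. F \<subseteq> H \<and> H \<subset> G}. mobius L F H)"
    using False assms finite_flat[of G] by (subst mobius.simps) auto
  then show ?thesis using False unfolding eq by (subst sum.insert) (use fin in auto)
qed

text \<open>Downward closure of \<open>P\<close> keeps every \<open>K\<close> below a selected
  \<open>H\<close> inside the selection, so both sides run over the same pairs. It is applied with
  \<open>P\<close> trivial and with \<open>P\<close> the avoidance of an element.\<close>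

lemma sum_interval_swap:
  fixes f :: "'a set \<Rightarrow> 'a set \<Rightarrow> 'b::comm_monoid_add"
  assumes "\<And>H. P H \<Longrightarrow> \<forall>K\<in>L. K \<subseteq> H \<longrightarrow> P K"
  shows "(\<Sum>H\<in>{H \<in> interval F G. P H}. \<Sum>K\<in>interval F H. f K H) =
    (\<Sum>K\<in>{K \<in> interval F G. P K}. \<Sum>H\<in>{H \<in> interval K G. P H}. f K H)"
proof -
  have "(\<Sum>H\<in>{H \<in> interval F G. P H}. \<Sum>K\<in>interval F H. f K H) =
    (\<Sum>H\<in>{H \<in> interval F G. P H}. \<Sum>K\<in>{K. K \<in> {K \<in> interval F G. P K} \<and> K \<subseteq> H}. f K H)"
  proof (rule sum.cong[OF refl])
    fix H assume "H \<in> {H \<in> interval F G. P H}"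
    then have "interval F H = {K. K \<in> {K \<in> interval F G. P K} \<and> K \<subseteq> H}"
      using assms[of H] by (auto simp: interval_def)
    then show "(\<Sum>K\<in>interval F H. f K H) =
      (\<Sum>K\<in>{K. K \<in> {K \<in> interval F G. P K} \<and> K \<subseteq> H}. f K H)" by simp
  qed
  also have "\<dots> = (\<Sum>K\<in>{K \<in> interval F G. P K}. \<Sum>H\<in>{H. H \<in> {H \<in> interval F G. P H} \<and> K \<subseteq> H}. f K H)"
    by (rule sum.swap_restrict) auto
  also have "\<dots> = (\<Sum>K\<in>{K \<in> interval F G. P K}. \<Sum>H\<in>{H \<in> interval K G. P H}. f K H)"
    by (intro sum.cong) (auto simp: interval_def)
  finally show ?thesis .
qed

text \<open>A one-sided inverse of the zeta function in the incidence algebra is two-sided. The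
  recursion for \<open>mobius\<close> runs over its upper argument, so this side needs an argument
  of its own.\<close>

lemma sum_mobius_lower:
  assumes "F \<in> L" "G \<in> L" "F \<subseteq> G"
  shows "(\<Sum>H\<in>interval F G. mobius L H G) = (if F = G then 1 else 0)"
  using assms(2,3)
proof (induction "card G" arbitrary: G rule: less_induct)
  case less
  define \<nu> where "\<nu> K = (\<Sum>H\<in>interval F K. mobius L H K)" for K
  \<comment> \<open>Associativity in the incidence algebra: zeta mu zeta = zeta, since mu zeta is
    the identity. All values of \<open>\<nu>\<close> below \<open>G\<close> are known by induction,
    so the total 1 determines the value at \<open>G\<close>.\<close>
  have "(\<Sum>K\<in>interval F G. \<nu> K) = (\<Sum>H\<in>interval F G. \<Sum>K\<in>interval H G. mobius L H K)"
    using sum_interval_swap[of "\<lambda>_. True" "\<lambda>H K. mobius L H K" F G] by (simp add: \<nu>_def)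
  also have "\<dots> = (\<Sum>H\<in>interval F G. if H = G then 1 else 0)"
    using less by (intro sum.cong refl sum_mobius_upper) (auto simp: interval_def)
  also have "\<dots> = 1"
    using less by (subst sum.delta) (auto simp: interval_def finite_L)
  finally have total: "(\<Sum>K\<in>interval F G. \<nu> K) = 1" .
  have \<nu>_less: "\<nu> K = (if F = K then 1 else 0)" if "K \<in> interval F G" "K \<noteq> G" for K
    unfolding \<nu>_def using that less(2) finite_flat[of G]
    by (intro less(1)) (auto simp: interval_def intro!: psubset_card_mono)
  show ?case
  proof (cases "F = G")
    case True
    then have "interval F G = {F}" using assms(1) by (auto simp: interval_def)
    then show ?thesis using True by simp
  next
    case False
    have "(\<Sum>K\<in>interval F G. \<nu> K) = \<nu> G + (\<Sum>K\<in>interval F G - {G}. \<nu> K)"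
      using less by (intro sum.remove finite_interval) (auto simp: interval_def)
    also have "(\<Sum>K\<in>interval F G - {G}. \<nu> K) = (\<Sum>K\<in>interval F G - {G}. if F = K then 1 else 0)"
      by (intro sum.cong refl \<nu>_less) auto
    also have "\<dots> = 1"
    proof -
      have "F \<in> interval F G - {G}" using False assms(1) less by (auto simp: interval_def)
      then show ?thesis by simp
    qed
    finally show ?thesis using total False by (simp add: \<nu>_def)
  qed
qed

text \<open>
  By Weisner's theorem the Moebius values sum to zero over the fibres of \<open>H \<mapsto> H \<or> e\<close>; this
  pairs the flats containing \<open>e\<close> with those avoiding it.
\<close>

lemma chi_eq_avoiding:
  assumes F: "F \<in> L" and G: "G \<in> L" and FG: "F \<subseteq> G" and e: "e \<in> G - F"
  shows "chi F G = qvar1 *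
    (\<Sum>H\<in>{H \<in> interval F G. e \<notin> H}. of_int (mobius L F H) * qvar ^ (\<rho> G - Suc (\<rho> H)))"
proof -
  \<comment> \<open>\<open>J H\<close> will be the join of \<open>H\<close> and \<open>e\<close>:
    \<open>H\<close> itself if it contains \<open>e\<close>, otherwise a flat of rank one
    higher.\<close>
  have "\<exists>K\<in>L. insert e H \<subseteq> K \<and> (\<forall>H'\<in>L. insert e H \<subseteq> H' \<longrightarrow> K \<subseteq> H') \<and>
      (e \<notin> H \<longrightarrow> \<rho> K = Suc (\<rho> H))" if "H \<in> interval F G" for H
  proof (cases "e \<in> H")
    case True
    then show ?thesis using that by (intro bexI[of _ H]) (auto simp: interval_def)
  next
    case False
    then show ?thesis using join[of H G e] that e G by (auto simp: interval_def)
  qed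
  then obtain J where J: "\<And>H. H \<in> interval F G \<Longrightarrow> J H \<in> L \<and> insert e H \<subseteq> J H \<and>
      (\<forall>H'\<in>L. insert e H \<subseteq> H' \<longrightarrow> J H \<subseteq> H') \<and> (e \<notin> H \<longrightarrow> \<rho> (J H) = Suc (\<rho> H))"
    by metis
  have J_self: "J H = H" if "H \<in> interval F G" "e \<in> H" for H
    using J[OF that(1)] that by (auto simp: interval_def)
  have J_sub: "J H \<subseteq> K" if "H \<in> interval F G" "K \<in> L" "e \<in> K" "H \<subseteq> K" for H K
    using J[OF that(1)] that by auto
  \<comment> \<open>The Moebius values on [F, K] sum to zero and are grouped by \<open>J\<close>.
    The fibres over flats smaller than \<open>K\<close> vanish by induction, so the fibre over
    \<open>K\<close> vanishes as well.\<close>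
  have weisner: "(\<Sum>H\<in>{H \<in> interval F G. J H = K}. mobius L F H) = 0"
    if "K \<in> interval F G" "e \<in> K" for K
    using that
  proof (induction "card K" arbitrary: K rule: less_induct)
    case less
    let ?A = "{K' \<in> interval F K. e \<in> K'}"
    have K: "K \<in> L" "F \<subseteq> K" "K \<subseteq> G" using less by (auto simp: interval_def)
    have sub: "interval F K \<subseteq> interval F G" using K by (auto simp: interval_def)
    have "(\<Sum>K'\<in>?A. \<Sum>H\<in>{H \<in> interval F K. J H = K'}. mobius L F H) = (\<Sum>H\<in>interval F K. mobius L F H)"
    proof (rule sum.group)
      show "J ` interval F K \<subseteq> ?A"
      proof (intro image_subsetI)
        fix H assume H: "H \<in> interval F K"
        with sub have H': "H \<in> interval F G" by auto
        show "J H \<in> ?A" using J[OF H'] J_sub[OF H' K(1) less(3)] H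
          by (auto simp: interval_def)
      qed
    qed auto
    also have "\<dots> = 0"
      using sum_mobius_upper[OF F K(1,2)] e less(3) by auto
    also have "(\<Sum>K'\<in>?A. \<Sum>H\<in>{H \<in> interval F K. J H = K'}. mobius L F H) =
       (\<Sum>K'\<in>?A. \<Sum>H\<in>{H \<in> interval F G. J H = K'}. mobius L F H)"
    proof (intro sum.cong refl)
      fix K' assume "K' \<in> ?A"
      then have "H \<subseteq> K" if "H \<in> interval F G" "J H = K'" for H
        using J[OF that(1)] that(2) by (auto simp: interval_def)
      then show "{H \<in> interval F K. J H = K'} = {H \<in> interval F G. J H = K'}"
        using sub by (auto simp: interval_def)
    qed
    also have "\<dots> = (\<Sum>H\<in>{H \<in> interval F G. J H = K}. mobius L F H) +
       (\<Sum>K'\<in>?A - {K}. \<Sum>H\<in>{H \<in> interval F G. J H = K'}. mobius L F H)"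
      using less K by (intro sum.remove) (auto simp: interval_def finite_L)
    also have "(\<Sum>K'\<in>?A - {K}. \<Sum>H\<in>{H \<in> interval F G. J H = K'}. mobius L F H) = 0"
    proof (rule sum.neutral, rule ballI)
      fix K' assume K': "K' \<in> ?A - {K}"
      then have "K' \<subset> K" "K' \<in> interval F G" "e \<in> K'"
        using K by (auto simp: interval_def)
      moreover from this have "card K' < card K"
        using finite_flat[OF K(1)] by (intro psubset_card_mono)
      ultimately show "(\<Sum>H\<in>{H \<in> interval F G. J H = K'}. mobius L F H) = 0"
        by (intro less(1))
    qed
    finally show ?case by simp
  qed
  let ?N = "{H \<in> interval F G. e \<notin> H}" and ?Y = "{H \<in> interval F G. e \<in> H}"
  have fibre: "mobius L F K = - (\<Sum>H\<in>{H \<in> ?N. J H = K}. mobius L F H)" if "K \<in> ?Y" for K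
  proof -
    have "{H \<in> interval F G. J H = K} = insert K {H \<in> ?N. J H = K}"
      using that J_self by auto
    then have "0 = (\<Sum>H\<in>insert K {H \<in> ?N. J H = K}. mobius L F H)"
      using weisner[of K] that by simp
    also have "\<dots> = mobius L F K + (\<Sum>H\<in>{H \<in> ?N. J H = K}. mobius L F H)"
      using that by (intro sum.insert) auto
    finally show ?thesis by simp
  qed
  have "(\<Sum>K\<in>?Y. of_int (mobius L F K) * qvar ^ (\<rho> G - \<rho> K)) =
     (\<Sum>K\<in>?Y. \<Sum>H\<in>{H \<in> ?N. J H = K}. - (of_int (mobius L F H) * qvar ^ (\<rho> G - Suc (\<rho> H))))"
  proof (rule sum.cong[OF refl])
    fix K assume K: "K \<in> ?Y"
    have "of_int (mobius L F K) * qvar ^ (\<rho> G - \<rho> K) =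
      (\<Sum>H\<in>{H \<in> ?N. J H = K}. - (of_int (mobius L F H) * qvar ^ (\<rho> G - \<rho> K)))"
      by (simp add: fibre[OF K] of_int_sum sum_negf sum_distrib_right)
    also have "\<dots> = (\<Sum>H\<in>{H \<in> ?N. J H = K}. - (of_int (mobius L F H) * qvar ^ (\<rho> G - Suc (\<rho> H))))"
    proof (rule sum.cong[OF refl])
      fix H assume "H \<in> {H \<in> ?N. J H = K}"
      then have "\<rho> K = Suc (\<rho> H)" using J[of H] by auto
      then show "- (of_int (mobius L F H) * qvar ^ (\<rho> G - \<rho> K)) =
          - (of_int (mobius L F H) * qvar ^ (\<rho> G - Suc (\<rho> H)))" by (simp only:)
    qed
    finally show "of_int (mobius L F K) * qvar ^ (\<rho> G - \<rho> K) =
      (\<Sum>H\<in>{H \<in> ?N. J H = K}. - (of_int (mobius L F H) * qvar ^ (\<rho> G - Suc (\<rho> H))))" .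
  qed
  also have "\<dots> = (\<Sum>H\<in>?N. - (of_int (mobius L F H) * qvar ^ (\<rho> G - Suc (\<rho> H))))"
  proof (rule sum.group)
    show "J ` ?N \<subseteq> ?Y"
    proof (intro image_subsetI)
      fix H assume H: "H \<in> ?N"
      then have H': "H \<in> interval F G" by simp
      show "J H \<in> ?Y" using J[OF H'] J_sub[OF H' G] e H'
        by (auto simp: interval_def)
    qed
  qed auto
  finally have Y: "(\<Sum>K\<in>?Y. of_int (mobius L F K) * qvar ^ (\<rho> G - \<rho> K)) =
     (\<Sum>H\<in>?N. - (of_int (mobius L F H) * qvar ^ (\<rho> G - Suc (\<rho> H))))" .
  have split: "interval F G = ?N \<union> ?Y" by auto
  have "chi F G = (\<Sum>H\<in>?N. of_int (mobius L F H) * qvar ^ (\<rho> G - \<rho> H)) +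
     (\<Sum>H\<in>?Y. of_int (mobius L F H) * qvar ^ (\<rho> G - \<rho> H))"
    unfolding chi_def by (subst split, rule sum.union_disjoint) auto
  also have "\<dots> = (\<Sum>H\<in>?N. of_int (mobius L F H) * qvar ^ (\<rho> G - \<rho> H) -
      of_int (mobius L F H) * qvar ^ (\<rho> G - Suc (\<rho> H)))"
    unfolding Y by (simp add: sum_subtractf sum_negf)
  also have "\<dots> = (\<Sum>H\<in>?N. qvar1 * (of_int (mobius L F H) * qvar ^ (\<rho> G - Suc (\<rho> H))))"
  proof (rule sum.cong[OF refl])
    fix H assume "H \<in> ?N"
    then have "\<rho> H < \<rho> G" using rank_strict[of H G] G e by (auto simp: interval_def)
    then have "\<rho> G - \<rho> H = Suc (\<rho> G - Suc (\<rho> H))" by simp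
    moreover have "qvar1 = qvar - 1" by (simp add: one_pCons)
    ultimately show "of_int (mobius L F H) * qvar ^ (\<rho> G - \<rho> H) -
      of_int (mobius L F H) * qvar ^ (\<rho> G - Suc (\<rho> H)) =
      qvar1 * (of_int (mobius L F H) * qvar ^ (\<rho> G - Suc (\<rho> H)))"
      by (simp only: power_Suc left_diff_distrib right_diff_distrib mult_1_left mult.left_commute)
  qed
  finally show ?thesis by (simp only: sum_distrib_left)
qed

lemma rchi_eq_avoiding:
  assumes "F \<in> L" "G \<in> L" "F \<subseteq> G" "e \<in> G - F"
  shows "rchi F G = (\<Sum>H\<in>{H \<in> interval F G. e \<notin> H}. of_int (mobius L F H) * qvar ^ (\<rho> G - Suc (\<rho> H)))"
  unfolding rchi_def chi_eq_avoiding[OF assms] by (rule nonzero_mult_div_cancel_left) simp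

lemma chi_eq_rchi:
  assumes "F \<in> L" "G \<in> L" "F \<subset> G"
  shows "chi F G = qvar1 * rchi F G"
proof -
  obtain e where "e \<in> G - F" using assms by auto
  then show ?thesis using assms by (simp only: chi_eq_avoiding rchi_eq_avoiding psubset_imp_subset)
qed

lemma chi_refl: "F \<in> L \<Longrightarrow> chi F F = 1"
proof -
  assume "F \<in> L"
  then have "interval F F = {F}" by (auto simp: interval_def)
  then show ?thesis by (simp add: chi_def)
qed

text \<open>At y = -1 one has q = 1, so the powers in \<open>rchi_eq_avoiding\<close> disappear and
  only Moebius values remain.\<close>

lemma twist_eq_avoiding:
  assumes "F \<in> L" "G \<in> L" "F \<subseteq> G" "e \<in> G - F"
  shows "twist F G = qvar ^ (\<rho> G - Suc (\<rho> F)) *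
    of_int (\<Sum>H\<in>{H \<in> interval F G. e \<notin> H}. mobius L F H)"
  unfolding twist_def rchi_eq_avoiding[OF assms] by (simp add: poly_sum)

text \<open>After expansion the exponents of q add up to \<open>\<rho> G - Suc (\<rho> J)\<close>,
  which is independent of the middle flat \<open>H\<close>. Summing over \<open>H\<close> in [J, K]
  is then Moebius inversion and leaves \<open>J = K\<close>.\<close>

lemma rchi_twist:
  assumes F: "F \<in> L" and G: "G \<in> L" and FG: "F \<subseteq> G" and e: "e \<in> G - F"
  shows "rchi F G = (\<Sum>H\<in>{H \<in> interval F G. e \<notin> H}. chi F H * twist H G)"
proof -
  let ?I = "\<lambda>H. {K \<in> interval H G. e \<notin> K}"
  have "(\<Sum>H\<in>?I F. chi F H * twist H G) =
    (\<Sum>H\<in>?I F. \<Sum>K\<in>?I H. \<Sum>J\<in>interval F H.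
       of_int (mobius L F J) * qvar ^ (\<rho> G - Suc (\<rho> J)) * of_int (mobius L H K))"
  proof (rule sum.cong[OF refl])
    fix H assume H: "H \<in> ?I F"
    then have H': "H \<in> L" "H \<subset> G" "e \<in> G - H" using e by (auto simp: interval_def)
    have "twist H G = (\<Sum>K\<in>?I H. qvar ^ (\<rho> G - Suc (\<rho> H)) * of_int (mobius L H K))"
      using H' G by (simp only: twist_eq_avoiding psubset_imp_subset of_int_sum sum_distrib_left)
    then have "chi F H * twist H G = (\<Sum>J\<in>interval F H. \<Sum>K\<in>?I H.
       (of_int (mobius L F J) * qvar ^ (\<rho> H - \<rho> J)) *
       (qvar ^ (\<rho> G - Suc (\<rho> H)) * of_int (mobius L H K)))"
      by (simp only: chi_def sum_product)
    also have "\<dots> = (\<Sum>J\<in>interval F H. \<Sum>K\<in>?I H.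
       of_int (mobius L F J) * qvar ^ (\<rho> G - Suc (\<rho> J)) * of_int (mobius L H K))"
    proof (intro sum.cong refl)
      fix J K assume J: "J \<in> interval F H"
      have "\<rho> J \<le> \<rho> H" "\<rho> H < \<rho> G"
        using J H' G rank_mono[of J H] rank_strict[of H G] by (auto simp: interval_def)
      then have "\<rho> G - Suc (\<rho> J) = (\<rho> H - \<rho> J) + (\<rho> G - Suc (\<rho> H))" by simp
      then show "(of_int (mobius L F J) * qvar ^ (\<rho> H - \<rho> J)) *
         (qvar ^ (\<rho> G - Suc (\<rho> H)) * of_int (mobius L H K)) =
         of_int (mobius L F J) * qvar ^ (\<rho> G - Suc (\<rho> J)) * of_int (mobius L H K)"
        by (simp only: power_add mult.assoc)
    qed
    also have "\<dots> = (\<Sum>K\<in>?I H. \<Sum>J\<in>interval F H.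
       of_int (mobius L F J) * qvar ^ (\<rho> G - Suc (\<rho> J)) * of_int (mobius L H K))"
      by (rule sum.swap)
    finally show "chi F H * twist H G = (\<Sum>K\<in>?I H. \<Sum>J\<in>interval F H.
       of_int (mobius L F J) * qvar ^ (\<rho> G - Suc (\<rho> J)) * of_int (mobius L H K))" .
  qed
  also have "\<dots> = (\<Sum>K\<in>?I F. \<Sum>H\<in>interval F K. \<Sum>J\<in>interval F H.
       of_int (mobius L F J) * qvar ^ (\<rho> G - Suc (\<rho> J)) * of_int (mobius L H K))"
    by (rule sum_interval_swap[symmetric]) auto
  also have "\<dots> = (\<Sum>K\<in>?I F. of_int (mobius L F K) * qvar ^ (\<rho> G - Suc (\<rho> K)))"
  proof (rule sum.cong[OF refl])
    fix K assume K: "K \<in> ?I F"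
    have "(\<Sum>H\<in>interval F K. \<Sum>J\<in>interval F H.
       of_int (mobius L F J) * qvar ^ (\<rho> G - Suc (\<rho> J)) * of_int (mobius L H K)) =
       (\<Sum>J\<in>interval F K. \<Sum>H\<in>interval J K.
       of_int (mobius L F J) * qvar ^ (\<rho> G - Suc (\<rho> J)) * of_int (mobius L H K))"
      using sum_interval_swap[of "\<lambda>_. True" _ F K] by simp
    also have "\<dots> = (\<Sum>J\<in>interval F K. of_int (mobius L F J) * qvar ^ (\<rho> G - Suc (\<rho> J)) *
        of_int (\<Sum>H\<in>interval J K. mobius L H K))"
      by (simp only: of_int_sum sum_distrib_left)
    also have "\<dots> = (\<Sum>J\<in>interval F K. of_int (mobius L F J) * qvar ^ (\<rho> G - Suc (\<rho> J)) *
        of_int (if J = K then 1 else 0))"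
      using K by (intro sum.cong refl arg_cong2[where f = "(*)"] arg_cong[where f = of_int] sum_mobius_lower)
        (auto simp: interval_def)
    also have "\<dots> = (\<Sum>J\<in>interval F K. if J = K then of_int (mobius L F J) * qvar ^ (\<rho> G - Suc (\<rho> J)) else 0)"
      by (intro sum.cong) auto
    also have "\<dots> = of_int (mobius L F K) * qvar ^ (\<rho> G - Suc (\<rho> K))"
      using K by (subst sum.delta) (auto simp: interval_def finite_L)
    finally show "(\<Sum>H\<in>interval F K. \<Sum>J\<in>interval F H.
       of_int (mobius L F J) * qvar ^ (\<rho> G - Suc (\<rho> J)) * of_int (mobius L H K)) =
       of_int (mobius L F K) * qvar ^ (\<rho> G - Suc (\<rho> K))" .
  qed
  also have "\<dots> = rchi F G" using rchi_eq_avoiding[OF assms] ..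
  finally show ?thesis ..
qed

text \<open>The term \<open>H = F\<close> of \<open>rchi_twist\<close> is \<open>twist F G\<close>.
  In this form the right-hand side is the total drop that \<open>telescope\<close> produces in
  \<open>compatible_exists\<close>.\<close>

lemma twist_recursion:
  assumes F: "F \<in> L" and G: "G \<in> L" and e: "F \<subseteq> G" "e \<in> G - F"
  shows "rchi F G - twist F G = qvar1 * (\<Sum>H\<in>{H \<in> interval F G. F \<noteq> H \<and> e \<notin> H}. rchi F H * twist H G)"
proof -
  have "{H \<in> interval F G. e \<notin> H} = insert F {H \<in> interval F G. F \<noteq> H \<and> e \<notin> H}"
    using assms by (auto simp: interval_def)
  then have "rchi F G = (\<Sum>H\<in>insert F {H \<in> interval F G. F \<noteq> H \<and> e \<notin> H}. chi F H * twist H G)"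
    using rchi_twist[OF assms] by simp
  also have "\<dots> = twist F G + (\<Sum>H\<in>{H \<in> interval F G. F \<noteq> H \<and> e \<notin> H}. chi F H * twist H G)"
    using F by (subst sum.insert) (auto simp: chi_refl)
  also have "(\<Sum>H\<in>{H \<in> interval F G. F \<noteq> H \<and> e \<notin> H}. chi F H * twist H G) =
     (\<Sum>H\<in>{H \<in> interval F G. F \<noteq> H \<and> e \<notin> H}. qvar1 * (rchi F H * twist H G))"
    using F by (intro sum.cong refl) (simp only: interval_def mem_Collect_eq chi_eq_rchi psubset_eq mult.assoc simp_thms)
  finally show ?thesis by (simp only: sum_distrib_left add_diff_cancel_left')
qed

end

section \<open>Functions with prescribed differences\<close>

definition avoid :: "'a \<Rightarrow> 'a set \<Rightarrow> int" where
  "avoid e K = (if e \<in> K then 0 else 1)"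

definition contain :: "'a \<Rightarrow> 'a set \<Rightarrow> int" where
  "contain e K = (if e \<in> K then 1 else 0)"

definition step_diff :: "'v \<Rightarrow> (('v \<Rightarrow> int) \<Rightarrow> 'b::ab_group_add) \<Rightarrow> ('v \<Rightarrow> int) \<Rightarrow> 'b" where
  "step_diff H f m = f m - f (m(H := m H + 1))"

definition depends_on :: "'v set \<Rightarrow> (('v \<Rightarrow> int) \<Rightarrow> 'b) \<Rightarrow> bool" where
  "depends_on P f \<longleftrightarrow> (\<forall>m m'. (\<forall>K\<in>P. m K = m' K) \<longrightarrow> f m = f m')"

lemma depends_onD: "depends_on P f \<Longrightarrow> (\<And>K. K \<in> P \<Longrightarrow> m K = m' K) \<Longrightarrow> f m = f m'"
  unfolding depends_on_def by blast

text \<open>Partial sums starting at 0, taken in both directions because exponents may be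
  negative.\<close>

lemma antidifference:
  fixes h :: "int \<Rightarrow> 'b::ab_group_add"
  shows "\<exists>S. S 0 = 0 \<and> (\<forall>s. S s - S (s + 1) = h s)"
proof -
  define S where "S s = (if s \<ge> 0 then - sum h {0..<s} else sum h {s..<0})" for s
  have "S s - S (s + 1) = h s" for s
  proof (cases "s \<ge> 0")
    case True
    then have "{0..<s + 1} = insert s {0..<s}" by auto
    then show ?thesis using True by (simp add: S_def)
  next
    case False
    then have "{s..<0} = insert s {s + 1..<0}" by auto
    then have "sum h {s..<0} = h s + sum h {s + 1..<0}" by simp
    then show ?thesis using False by (cases "s = -1") (auto simp: S_def)
  qed
  then show ?thesis by (intro exI[of _ S]) (simp add: S_def)
qed

text \<open>Symmetry of the mixed differences makes summation path independent. The induction adds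
  one axis \<open>K\<close> at a time and sums along it, starting from the hyperplane
  \<open>m K = 0\<close>.\<close>

lemma discrete_potential:
  fixes \<omega> :: "'v \<Rightarrow> ('v \<Rightarrow> int) \<Rightarrow> 'b::ab_group_add"
  assumes "finite P"
    and "\<And>H K m. H \<in> P \<Longrightarrow> K \<in> P \<Longrightarrow> step_diff K (\<omega> H) m = step_diff H (\<omega> K) m"
    and "\<And>H. H \<in> P \<Longrightarrow> depends_on P (\<omega> H)"
  shows "\<exists>f. depends_on P f \<and> f (\<lambda>_. 0) = v \<and> (\<forall>H\<in>P. \<forall>m. step_diff H f m = \<omega> H m)"
proof -
  have "\<exists>f. f (\<lambda>_. 0) = v \<and> (\<forall>H\<in>P. \<forall>m. step_diff H f m = \<omega> H m)"
    using assms(1,2)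
  proof (induction P rule: finite_induct)
    case empty
    show ?case by (intro exI[of _ "\<lambda>_. v"]) simp
  next
    case (insert K P)
    have "\<exists>f. f (\<lambda>_. 0) = v \<and> (\<forall>H\<in>P. \<forall>m. step_diff H f m = \<omega> H m)"
      by (intro insert.IH insert.prems insertI2)
    then obtain f where f: "f (\<lambda>_. 0) = v" "\<And>H m. H \<in> P \<Longrightarrow> step_diff H f m = \<omega> H m"
      by blast
    have "\<forall>n. \<exists>S. S 0 = 0 \<and> (\<forall>s. S s - S (s + 1) = \<omega> K (n(K := s)))"
      by (intro allI antidifference)
    then obtain S where S: "\<And>n. S n 0 = 0" "\<And>n s. S n s - S n (s + 1) = \<omega> K (n(K := s))"
      by metis
    define g where "g m = f (m(K := 0)) + S (m(K := 0)) (m K)" for m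
    have "step_diff K g m = \<omega> K m" for m
      using S(2)[of "m(K := 0)" "m K"] by (simp add: step_diff_def g_def)
    moreover have "step_diff H g m = \<omega> H m" if H: "H \<in> P" for H m
    proof -
      have HK: "H \<noteq> K" using H insert by auto
      define n where "n = m(K := 0)"
      define n' where "n' = n(H := n H + 1)"
      \<comment> \<open>Both sides vanish at \<open>s = 0\<close>, and by closedness they have the
        same difference in \<open>s\<close>.\<close>
      have D: "S n s - S n' s = \<omega> H (n(K := s)) - \<omega> H n" for s
      proof -
        have step: "(S n s - S n' s) - (S n (s + 1) - S n' (s + 1)) = \<omega> H (n(K := s)) - \<omega> H (n(K := s + 1))" for s
        proof -
          have "(S n s - S n' s) - (S n (s + 1) - S n' (s + 1)) = \<omega> K (n(K := s)) - \<omega> K (n'(K := s))"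
            using S(2)[of n s] S(2)[of n' s] by (simp add: algebra_simps)
          also have "\<dots> = step_diff H (\<omega> K) (n(K := s))"
            using HK by (simp add: step_diff_def n'_def fun_upd_twist)
          also have "\<dots> = step_diff K (\<omega> H) (n(K := s))"
            using insert.prems[of K H] H by simp
          finally show ?thesis by (simp add: step_diff_def)
        qed
        define E where "E s = S n s - S n' s - \<omega> H (n(K := s))" for s
        have E: "E (s + 1) = E s" for s using step[of s] by (simp add: E_def algebra_simps)
        have "E s = E 0"
        proof (induction s rule: int_induct[where k = 0])
          case (step2 s)
          then show ?case using E[of "s - 1"] by simp
        qed (simp_all add: E)
        moreover have "n(K := 0) = n" by (simp add: n_def)
        ultimately show ?thesis by (simp add: E_def S(1) algebra_simps)
      qed
      have "m(H := m H + 1, K := 0) = n'" "m H = n H"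
        using HK by (auto simp: n'_def n_def)
      then have "step_diff H g m = f n - f n' + (S n (m K) - S n' (m K))"
        using HK by (simp add: step_diff_def g_def n_def[symmetric] fun_upd_twist)
      also have "f n - f n' = \<omega> H n" using f(2)[OF H, of n] by (simp add: step_diff_def n'_def)
      finally have "step_diff H g m = \<omega> H (n(K := m K))" using D[of "m K"] by simp
      moreover have "n(K := m K) = m" by (simp add: n_def)
      ultimately show ?thesis by simp
    qed
    moreover have "g (\<lambda>_. 0) = v"
      using f(1) S(1) by (simp add: g_def fun_upd_idem)
    ultimately show ?case by blast
  qed
  then obtain f where f: "f (\<lambda>_. 0) = v" "\<And>H m. H \<in> P \<Longrightarrow> step_diff H f m = \<omega> H m"
    by auto
  \<comment> \<open>Freezing the exponents outside \<open>P\<close> at 0 makes the potential depend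
    on \<open>P\<close> only; the prescribed differences survive because they do not see those
    exponents either.\<close>
  define g where "g m = f (\<lambda>K. if K \<in> P then m K else 0)" for m
  have "step_diff H g m = \<omega> H m" if H: "H \<in> P" for H m
  proof -
    have "(\<lambda>K. if K \<in> P then (m(H := m H + 1)) K else 0) = (\<lambda>K. if K \<in> P then m K else 0)(H := m H + 1)"
      using H by auto
    then have "step_diff H g m = step_diff H f (\<lambda>K. if K \<in> P then m K else 0)"
      using H unfolding step_diff_def g_def by (simp only: if_True)
    also have "\<dots> = \<omega> H (\<lambda>K. if K \<in> P then m K else 0)"
      by (rule f(2)[OF H])
    also have "\<dots> = \<omega> H m"
      by (rule depends_onD[OF assms(3)[OF H]]) simp
    finally show ?thesis .
  qed
  moreover have "depends_on P g"
    unfolding depends_on_def g_def by (intro allI impI arg_cong[where f = f]) auto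
  moreover have "g (\<lambda>_. 0) = v" using f(1) by (simp add: g_def)
  ultimately show ?thesis by blast
qed

text \<open>The exponents in the finite set \<open>P\<close> can be set to 0 one at a time without
  changing the value, and the others do not matter.\<close>

lemma diff_zero_imp_const:
  fixes f :: "('v \<Rightarrow> int) \<Rightarrow> 'b::ab_group_add"
  assumes fin: "finite P" and dep: "depends_on P f"
    and zero: "\<And>H m. H \<in> P \<Longrightarrow> step_diff H f m = 0"
  shows "f m = f (\<lambda>_. 0)"
proof -
  have upd: "f (m(H := s)) = f (m(H := 0))" if "H \<in> P" for H m s
  proof -
    define E where "E s = f (m(H := s))" for s
    have E: "E (s + 1) = E s" for s using zero[OF that, of "m(H := s)"] by (simp add: E_def step_diff_def)
    have "E s = E 0"
    proof (induction s rule: int_induct[where k = 0])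
      case (step2 s)
      then show ?case using E[of "s - 1"] by simp
    qed (simp_all add: E)
    then show ?thesis by (simp only: E_def)
  qed
  have "f (\<lambda>K. if K \<in> Q then 0 else m K) = f m" if "finite Q" "Q \<subseteq> P" for Q
    using that
  proof (induction Q rule: finite_induct)
    case (insert H Q)
    have "(\<lambda>K. if K \<in> insert H Q then 0 else m K) = (\<lambda>K. if K \<in> Q then 0 else m K)(H := 0)"
      by auto
    then have "f (\<lambda>K. if K \<in> insert H Q then 0 else m K) = f (\<lambda>K. if K \<in> Q then 0 else m K)"
      using upd[of H "\<lambda>K. if K \<in> Q then 0 else m K" "if H \<in> Q then 0 else m H"] insert.prems
      by (simp add: fun_upd_idem)
    then show ?case using insert by simp
  qed simp
  from this[OF fin order_refl] show ?thesis
    using depends_onD[OF dep, of "\<lambda>K. if K \<in> P then 0 else m K" "\<lambda>_. 0"] by simp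
qed

section \<open>Functionals of minors, built by induction on intervals\<close>

context ranked_flats
begin

definition open_interval :: "'a set \<Rightarrow> 'a set \<Rightarrow> 'a set set" where
  "open_interval F G = {H \<in> L. F \<subset> H \<and> H \<subset> G}"

text \<open>
  \<open>h m\<close> is the value of the functional of the minor \<open>M|G/F\<close> on \<open>\<Prod>\<^sub>H (1 - x\<^sub>H)\<^sup>m\<close> with exponents
  \<open>m H \<in> \<int>\<close>. In the clause on differences, multiplication by \<open>x\<^sub>H\<close> restricts to the product of
  the minors on \<open>[F, H]\<close> and \<open>[H, G]\<close>, and the exponent of \<open>1 - x\<^sub>H\<close> is moved to the other
  variables: the linear relation for \<open>i \<in> H\<close> and \<open>j \<notin> H\<close> expresses \<open>1 - x\<^sub>H\<close> on that product.
\<close>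

definition compatible ::
  "('a set \<Rightarrow> 'a set \<Rightarrow> ('a set \<Rightarrow> int) \<Rightarrow> int poly) \<Rightarrow> 'a set \<Rightarrow> 'a set \<Rightarrow> (('a set \<Rightarrow> int) \<Rightarrow> int poly) \<Rightarrow> bool"
  where
  "compatible f F G h \<longleftrightarrow>
     depends_on (open_interval F G) h \<and>
     (\<forall>m. \<forall>i\<in>G - F. \<forall>j\<in>G - F. h (\<lambda>K. m K + avoid i K) = h (\<lambda>K. m K + avoid j K)) \<and>
     (\<forall>H\<in>open_interval F G. \<forall>m. \<forall>i\<in>H - F. \<forall>j\<in>G - H.
        step_diff H h m = qvar1 * f F H (\<lambda>K. m K - m H * contain i K) * f H G (\<lambda>K. m K - m H * avoid j K)) \<and>
     h (\<lambda>_. 0) = rchi F G \<and>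
     (\<forall>i\<in>G - F. h (avoid i) = twist F G)"

text \<open>Only pairs with one end strictly between \<open>F\<close> and \<open>G\<close> are
  consulted. This is what permits building the family by recursion on intervals.\<close>

lemma compatible_cong:
  assumes "\<And>H. H \<in> open_interval F G \<Longrightarrow> f F H = f' F H \<and> f H G = f' H G"
  shows "compatible f F G h \<longleftrightarrow> compatible f' F G h"
proof -
  have "(\<forall>m. \<forall>i\<in>H - F. \<forall>j\<in>G - H. step_diff H h m =
        qvar1 * f F H (\<lambda>K. m K - m H * contain i K) * f H G (\<lambda>K. m K - m H * avoid j K)) \<longleftrightarrow>
      (\<forall>m. \<forall>i\<in>H - F. \<forall>j\<in>G - H. step_diff H h m =
        qvar1 * f' F H (\<lambda>K. m K - m H * contain i K) * f' H G (\<lambda>K. m K - m H * avoid j K))"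
    if H: "H \<in> open_interval F G" for H
    unfolding assms[OF H, THEN conjunct1] assms[OF H, THEN conjunct2] ..
  then show ?thesis unfolding compatible_def by (simp only: cong: ball_cong)
qed

lemma compatible_depends: "compatible f F G h \<Longrightarrow> depends_on (open_interval F G) h"
  unfolding compatible_def by (elim conjE)

lemma compatible_zero: "compatible f F G h \<Longrightarrow> h (\<lambda>_. 0) = rchi F G"
  unfolding compatible_def by (elim conjE)

lemma compatible_avoid: "compatible f F G h \<Longrightarrow> i \<in> G - F \<Longrightarrow> h (avoid i) = twist F G"
  unfolding compatible_def by (elim conjE) (rule bspec)

lemma compatible_diff:
  "compatible f F G h \<Longrightarrow> H \<in> open_interval F G \<Longrightarrow> i \<in> H - F \<Longrightarrow> j \<in> G - H \<Longrightarrow>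
   step_diff H h m = qvar1 * f F H (\<lambda>K. m K - m H * contain i K) * f H G (\<lambda>K. m K - m H * avoid j K)"
  unfolding compatible_def by (elim conjE) (drule (1) bspec, drule spec, drule (1) bspec, erule (1) bspec)

text \<open>Unit shifts are exchanged one at a time. All integers \<open>t\<close> are needed, since
  the multiple transferred from a flat \<open>H\<close> is its exponent, of either sign.\<close>

lemma compatible_shift:
  assumes "compatible f F G h" and ij: "i \<in> G - F" "j \<in> G - F"
  shows "h (\<lambda>K. m K + t * avoid i K) = h (\<lambda>K. m K + t * avoid j K)"
proof -
  have one: "h (\<lambda>K. m K + avoid i K) = h (\<lambda>K. m K + avoid j K)" for m
    using assms unfolding compatible_def by blast
  show ?thesis
  proof (induction t arbitrary: m rule: int_induct[where k = 0])
    case base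
    show ?case by simp
  next
    case (step1 t)
    show ?case
      using step1.IH[of "\<lambda>K. m K + avoid i K"] one[of "\<lambda>K. m K + t * avoid j K"]
      by (simp add: algebra_simps)
  next
    case (step2 t)
    show ?case
      \<comment> \<open>The base point for \<open>one\<close> is chosen so that its two unit shifts
        are \<open>m + (t - 1) * avoid j\<close> and \<open>m - avoid i + t * avoid j\<close>; the
        latter is where the induction hypothesis arrives.\<close>
      using step2.IH[of "\<lambda>K. m K - avoid i K"] one[of "\<lambda>K. m K - avoid i K - avoid j K + t * avoid j K"]
      by (simp add: algebra_simps)
  qed
qed

lemma compatible_contain:
  assumes "compatible f F G h" and "i \<in> G - F" "j \<in> G - F"
  shows "h (\<lambda>K. m K - t * contain i K) = h (\<lambda>K. m K - t * contain j K)"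
proof -
  have "m K - t * contain e K = (m K - t) + t * avoid e K" for e K
    by (simp add: contain_def avoid_def)
  then show ?thesis using compatible_shift[OF assms, of "\<lambda>K. m K - t" t] by (simp only:)
qed

text \<open>\<open>h\<close> is built from the difference clause and its value at 0 alone. The value
  at \<open>avoid i\<close> is computed next, because the shift invariance is deduced from
  it.\<close>

lemma compatible_exists:
  assumes F: "F \<in> L" and G: "G \<in> L" and FG: "F \<subset> G"
    and sub: "\<And>F' G'. F' \<in> L \<Longrightarrow> G' \<in> L \<Longrightarrow> F \<subseteq> F' \<Longrightarrow> F' \<subset> G' \<Longrightarrow> G' \<subseteq> G \<Longrightarrow>
      F \<noteq> F' \<or> G \<noteq> G' \<Longrightarrow> compatible f F' G' (f F' G')"
  shows "\<exists>h. compatible f F G h"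
proof -
  define P where "P = open_interval F G"
  have finP: "finite P" using finite_L by (simp add: P_def open_interval_def)
  have PD: "H \<in> L" "F \<subset> H" "H \<subset> G" if "H \<in> P" for H
    using that by (auto simp: P_def open_interval_def)
  have lo: "compatible f F H (f F H)" and hi: "compatible f H G (f H G)" if "H \<in> P" for H
    using PD[OF that] F G by (auto intro!: sub)
  have mid: "compatible f K H (f K H)" if "K \<in> P" "H \<in> P" "K \<subset> H" for K H
    using PD[OF that(1)] PD[OF that(2)] that(3) by (intro sub) auto
  define w where "w H i j m = qvar1 * f F H (\<lambda>K. m K - m H * contain i K) *
      f H G (\<lambda>K. m K - m H * avoid j K)" for H i j m
  \<comment> \<open>Changing \<open>i\<close> or \<open>j\<close> exchanges multiples of
    \<open>contain\<close> or \<open>avoid\<close>, which the functionals of the smaller intervals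
    cannot distinguish.\<close>
  have w_indep: "w H i j = w H i' j'"
    if "H \<in> P" "i \<in> H - F" "i' \<in> H - F" "j \<in> G - H" "j' \<in> G - H" for H i i' j j'
  proof
    fix m
    show "w H i j m = w H i' j' m"
      using compatible_contain[OF lo[OF that(1)] that(2,3), of m "m H"]
        compatible_shift[OF hi[OF that(1)] that(4,5), of m "- m H"]
      by (simp add: w_def)
  qed
  define a where "a H = (SOME i. i \<in> H - F)" for H
  define b where "b H = (SOME j. j \<in> G - H)" for H
  have a: "a H \<in> H - F" and b: "b H \<in> G - H" if "H \<in> P" for H
    unfolding a_def b_def some_in_eq using PD[OF that] by auto
  define \<omega> where "\<omega> H = w H (a H) (b H)" for H
  have \<omega>: "\<omega> H = w H i j" if "H \<in> P" "i \<in> H - F" "j \<in> G - H" for H i j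
    unfolding \<omega>_def using that a b by (intro w_indep) auto
  have lo_cong: "f F H m = f F H m'" if "H \<in> P" "\<And>K. K \<in> L \<Longrightarrow> F \<subset> K \<Longrightarrow> K \<subset> H \<Longrightarrow> m K = m' K" for H m m'
    by (rule depends_onD[OF compatible_depends[OF lo[OF that(1)]]]) (auto simp: open_interval_def that)
  have hi_cong: "f H G m = f H G m'" if "H \<in> P" "\<And>K. K \<in> L \<Longrightarrow> H \<subset> K \<Longrightarrow> K \<subset> G \<Longrightarrow> m K = m' K" for H m m'
    by (rule depends_onD[OF compatible_depends[OF hi[OF that(1)]]]) (auto simp: open_interval_def that)
  \<comment> \<open>One element \<open>i\<close> of \<open>H - K\<close> serves both as the lower
    element for \<open>H\<close> and as the upper element for \<open>K\<close>. Both mixed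
    differences then become \<open>qvar1\<close> squared times \<open>A\<close>, \<open>B\<close>,
    \<open>C\<close>, belonging to [F, K], [K, H], [H, G].\<close>
  have closed_less: "step_diff K (\<omega> H) m = step_diff H (\<omega> K) m" if K: "K \<in> P" and H: "H \<in> P" and KH: "K \<subset> H" for H K m
  proof -
    obtain i where i: "i \<in> H - K" using KH by auto
    define i' where "i' = a K"
    define j where "j = b H"
    have i': "i' \<in> K - F" and j: "j \<in> G - H" unfolding i'_def j_def using a b K H by auto
    have iF: "i \<in> H - F" and iG: "i \<in> G - K" using i PD[OF K] PD[OF H] by auto
    define A where "A = f F K (\<lambda>X. m X - m K * contain i' X)"
    define B where "B = f K H (\<lambda>X. m X - m H * contain i X - m K * avoid i X)"
    define C where "C = f H G (\<lambda>X. m X - m H * avoid j X)"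
    have K_lo: "K \<in> open_interval F H" using K KH by (auto simp: P_def open_interval_def)
    have H_hi: "H \<in> open_interval K G" using H KH by (auto simp: P_def open_interval_def)
    have "step_diff K (f F H) (\<lambda>X. m X - m H * contain i X) = qvar1 *
        f F K (\<lambda>X. m X - m H * contain i X - (m K - m H * contain i K) * contain i' X) *
        f K H (\<lambda>X. m X - m H * contain i X - (m K - m H * contain i K) * avoid i X)"
      by (rule compatible_diff[OF lo[OF H] K_lo i' i])
    \<comment> \<open>No flat inside \<open>K\<close> contains \<open>i\<close>, so the exponent
      moved away from \<open>H\<close> does not reach [F, K].\<close>
    also have "f F K (\<lambda>X. m X - m H * contain i X - (m K - m H * contain i K) * contain i' X) = A"
      unfolding A_def by (rule lo_cong[OF K]) (use i in \<open>auto simp: contain_def\<close>)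
    also have "f K H (\<lambda>X. m X - m H * contain i X - (m K - m H * contain i K) * avoid i X) = B"
      using i by (simp add: B_def contain_def)
    finally have dK: "step_diff K (f F H) (\<lambda>X. m X - m H * contain i X) = qvar1 * A * B" .
    have "f H G (\<lambda>X. (m(K := m K + 1)) X - m H * avoid j X) = C"
      unfolding C_def by (rule hi_cong[OF H]) (use KH in auto)
    moreover have "(\<lambda>X. (m(K := m K + 1)) X - m H * contain i X) =
      (\<lambda>X. m X - m H * contain i X)(K := m K - m H * contain i K + 1)" by auto
    moreover have "(m(K := m K + 1)) H = m H" using KH by auto
    ultimately have "step_diff K (w H i j) m = qvar1 * step_diff K (f F H) (\<lambda>X. m X - m H * contain i X) * C"
      unfolding step_diff_def w_def C_def by (simp only: left_diff_distrib right_diff_distrib)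
    then have left: "step_diff K (\<omega> H) m = qvar1 * (qvar1 * A * B) * C"
      unfolding dK \<omega>[OF H iF j] .
    have "step_diff H (f K G) (\<lambda>X. m X - m K * avoid i X) = qvar1 *
        f K H (\<lambda>X. m X - m K * avoid i X - (m H - m K * avoid i H) * contain i X) *
        f H G (\<lambda>X. m X - m K * avoid i X - (m H - m K * avoid i H) * avoid j X)"
      by (rule compatible_diff[OF hi[OF K] H_hi i j])
    also have "f K H (\<lambda>X. m X - m K * avoid i X - (m H - m K * avoid i H) * contain i X) = B"
      using i by (simp add: B_def avoid_def algebra_simps)
    \<comment> \<open>Dually, every flat above \<open>H\<close> contains \<open>i\<close>, so the
      exponent moved away from \<open>K\<close> does not reach [H, G].\<close>
    also have "f H G (\<lambda>X. m X - m K * avoid i X - (m H - m K * avoid i H) * avoid j X) = C"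
      unfolding C_def by (rule hi_cong[OF H]) (use i in \<open>auto simp: avoid_def\<close>)
    finally have dH: "step_diff H (f K G) (\<lambda>X. m X - m K * avoid i X) = qvar1 * B * C" .
    have "f F K (\<lambda>X. (m(H := m H + 1)) X - m K * contain i' X) = A"
      unfolding A_def by (rule lo_cong[OF K]) (use KH in auto)
    moreover have "(\<lambda>X. (m(H := m H + 1)) X - m K * avoid i X) =
      (\<lambda>X. m X - m K * avoid i X)(H := m H - m K * avoid i H + 1)" by auto
    moreover have "(m(H := m H + 1)) K = m K" using KH by auto
    ultimately have "step_diff H (w K i' i) m = qvar1 * A * step_diff H (f K G) (\<lambda>X. m X - m K * avoid i X)"
      unfolding step_diff_def w_def A_def by (simp only: right_diff_distrib)
    then have "step_diff H (\<omega> K) m = qvar1 * A * (qvar1 * B * C)"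
      unfolding dH \<omega>[OF K i' iG] .
    with left show ?thesis by (simp only: ac_simps)
  qed
  have closed_incomp: "step_diff K (\<omega> H) m = 0" if K: "K \<in> P" and H: "H \<in> P" and KH: "\<not> K \<subseteq> H" "\<not> H \<subseteq> K" for H K m
  proof -
    have "H \<noteq> K" using KH by auto
    moreover have "f F H (\<lambda>X. (m(K := m K + 1)) X - m H * contain (a H) X) = f F H (\<lambda>X. m X - m H * contain (a H) X)"
      by (rule lo_cong[OF H]) (use KH in auto)
    moreover have "f H G (\<lambda>X. (m(K := m K + 1)) X - m H * avoid (b H) X) = f H G (\<lambda>X. m X - m H * avoid (b H) X)"
      by (rule hi_cong[OF H]) (use KH in auto)
    ultimately show ?thesis by (simp add: step_diff_def \<omega>_def w_def)
  qed
  have closed: "step_diff K (\<omega> H) m = step_diff H (\<omega> K) m" if K: "K \<in> P" and H: "H \<in> P" for H K m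
  proof -
    consider "K = H" | "K \<subset> H" | "H \<subset> K" | "\<not> K \<subseteq> H" "\<not> H \<subseteq> K" by blast
    then show ?thesis
      using closed_less[OF K H] closed_less[OF H K] closed_incomp[OF K H] closed_incomp[OF H K]
      by cases simp_all
  qed
  have "depends_on P (\<omega> H)" if H: "H \<in> P" for H
    unfolding depends_on_def
  proof (intro allI impI)
    fix m m' :: "'a set \<Rightarrow> int" assume eq: "\<forall>K\<in>P. m K = m' K"
    then have mH: "m H = m' H" using H by auto
    have "f F H (\<lambda>X. m X - m H * contain (a H) X) = f F H (\<lambda>X. m' X - m' H * contain (a H) X)"
      using eq mH PD[OF H] by (intro lo_cong[OF H]) (auto simp: P_def open_interval_def)
    moreover have "f H G (\<lambda>X. m X - m H * avoid (b H) X) = f H G (\<lambda>X. m' X - m' H * avoid (b H) X)"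
      using eq mH PD[OF H] by (intro hi_cong[OF H]) (auto simp: P_def open_interval_def)
    ultimately show "\<omega> H m = \<omega> H m'" by (simp add: \<omega>_def w_def)
  qed
  from discrete_potential[OF finP closed this]
  obtain h where h: "depends_on P h" "h (\<lambda>_. 0) = rchi F G" "\<And>H m. H \<in> P \<Longrightarrow> step_diff H h m = \<omega> H m"
    by metis
  have h_diff: "step_diff H h m = qvar1 * f F H (\<lambda>K. m K - m H * contain i K) * f H G (\<lambda>K. m K - m H * avoid j K)"
    if "H \<in> P" "i \<in> H - F" "j \<in> G - H" for H m i j
    using h(3)[OF that(1)] \<omega>[OF that] by (simp add: w_def)
  \<comment> \<open>Flats are switched off one at a time, a minimal \<open>H\<close> first. No other
    member of \<open>S\<close> lies inside \<open>H\<close>, so its lower factor is evaluated at 0;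
    and \<open>H\<close> lies above no other member, so their upper factors do not notice its
    removal.\<close>
  have telescope: "h (\<lambda>_. 0) - h (\<lambda>X. if X \<in> S then 1 else 0) =
      qvar1 * (\<Sum>H\<in>S. rchi F H * f H G (\<lambda>X. if X \<in> S then 1 else 0))" if "finite S" "S \<subseteq> P" for S
    using that
  proof (induction S rule: finite_psubset_induct)
    case (psubset S)
    show ?case
    proof (cases "S = {}")
      case True
      then show ?thesis by simp
    next
      case False
      with psubset obtain H where H: "H \<in> S" and min: "\<And>K. K \<in> S \<Longrightarrow> K \<subseteq> H \<Longrightarrow> H = K"
        using finite_has_minimal[OF psubset.hyps False] by metis
      define S' where "S' = S - {H}"
      let ?e = "\<lambda>S X. if X \<in> S then 1 else (0::int)"
      have HP: "H \<in> P" using H psubset by auto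
      have e: "?e S = (?e S')(H := ?e S' H + 1)" using H by (auto simp: S'_def)
      have "h (?e S') - h (?e S) = step_diff H h (?e S')"
        unfolding step_diff_def e[symmetric] ..
      also have "\<dots> = qvar1 * f F H (?e S') * f H G (?e S')"
        by (subst h_diff[OF HP a[OF HP] b[OF HP]]) (simp add: S'_def)
      also have "f F H (?e S') = f F H (\<lambda>_. 0)"
        using min by (intro lo_cong[OF HP]) (auto simp: S'_def)
      also have "\<dots> = rchi F H" by (rule compatible_zero[OF lo[OF HP]])
      also have "f H G (?e S') = f H G (?e S)"
        by (intro hi_cong[OF HP]) (auto simp: S'_def)
      finally have 1: "h (?e S') - h (?e S) = qvar1 * rchi F H * f H G (?e S)" .
      have "S' \<subset> S" "S' \<subseteq> P" using H psubset by (auto simp: S'_def)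
      from psubset.IH[OF this]
      have 2: "h (\<lambda>_. 0) - h (?e S') = qvar1 * (\<Sum>K\<in>S'. rchi F K * f K G (?e S'))" .
      have 3: "f K G (?e S') = f K G (?e S)" if "K \<in> S'" for K
        using that min psubset by (intro hi_cong) (auto simp: S'_def)
      have "h (\<lambda>_. 0) - h (?e S) = qvar1 * (rchi F H * f H G (?e S) + (\<Sum>K\<in>S'. rchi F K * f K G (?e S')))"
        using 1 2 by (simp only: distrib_left mult.assoc)
      also have "(\<Sum>K\<in>S'. rchi F K * f K G (?e S')) = (\<Sum>K\<in>S'. rchi F K * f K G (?e S))"
        using 3 by simp
      also have "rchi F H * f H G (?e S) + \<dots> = (\<Sum>K\<in>S. rchi F K * f K G (?e S))"
        unfolding S'_def using H psubset.hyps by (simp add: sum.remove)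
      finally show ?thesis .
    qed
  qed
  have h_avoid: "h (avoid i) = twist F G" if i: "i \<in> G - F" for i
  proof -
    \<comment> \<open>Within the open interval, \<open>avoid i\<close> is the indicator of
      \<open>S\<close>. Upper factors at this vector are \<open>twist H G\<close> by the hypothesis
      on smaller intervals.\<close>
    define S where "S = {H \<in> interval F G. F \<noteq> H \<and> i \<notin> H}"
    let ?e = "\<lambda>X. if X \<in> S then 1 else (0::int)"
    have SP: "S \<subseteq> P" using i by (auto simp: S_def P_def interval_def open_interval_def)
    have eS: "avoid i X = ?e X" if "X \<in> P" for X
      using that by (auto simp: avoid_def S_def P_def interval_def open_interval_def)
    have "rchi F G - h (avoid i) = h (\<lambda>_. 0) - h ?e"
      using h(2) depends_onD[OF h(1) eS] by simp
    also have "\<dots> = qvar1 * (\<Sum>H\<in>S. rchi F H * f H G ?e)"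
      using SP by (intro telescope finite_subset[OF SP finP])
    also have "(\<Sum>H\<in>S. rchi F H * f H G ?e) = (\<Sum>H\<in>S. rchi F H * twist H G)"
    proof (rule sum.cong[OF refl])
      fix H assume H: "H \<in> S"
      with SP have HP: "H \<in> P" by auto
      have "f H G ?e = f H G (avoid i)"
        using PD[OF HP] by (intro hi_cong[OF HP] eS[symmetric]) (auto simp: P_def open_interval_def)
      also have "\<dots> = twist H G"
        using i H by (intro compatible_avoid[OF hi[OF HP]]) (auto simp: S_def)
      finally show "rchi F H * f H G ?e = rchi F H * twist H G" by simp
    qed
    also have "qvar1 * \<dots> = rchi F G - twist F G"
      unfolding S_def using twist_recursion[OF F G _ i] FG by auto
    finally show ?thesis by simp
  qed
  \<comment> \<open>The right-hand side no longer mentions \<open>i\<close>. Above \<open>H\<close>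
    the shift is cancelled by the extra unit in the exponent of \<open>H\<close> if
    \<open>i \<notin> H\<close>, and is absent if \<open>i \<in> H\<close>; below \<open>H\<close>
    it becomes a shift by \<open>avoid (a H)\<close> in both cases.\<close>
  have diff_avoid: "step_diff H h (\<lambda>K. m K + avoid i K) = qvar1 *
      f F H (\<lambda>K. m K - m H * contain (a H) K + avoid (a H) K) * f H G (\<lambda>K. m K - m H * avoid (b H) K)"
    if H: "H \<in> P" and i: "i \<in> G - F" for H i m
  proof (cases "i \<in> H")
    case False
    then have i': "i \<in> G - H" using i by auto
    have "step_diff H h (\<lambda>K. m K + avoid i K) =
       qvar1 * f F H (\<lambda>K. m K + avoid i K - (m H + avoid i H) * contain (a H) K) *
       f H G (\<lambda>K. m K + avoid i K - (m H + avoid i H) * avoid i K)"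
      by (rule h_diff[OF H a[OF H] i'])
    also have "f F H (\<lambda>K. m K + avoid i K - (m H + avoid i H) * contain (a H) K) =
        f F H (\<lambda>K. m K - m H * contain (a H) K + avoid (a H) K)"
      by (rule lo_cong[OF H]) (use False in \<open>auto simp: avoid_def contain_def\<close>)
    also have "f H G (\<lambda>K. m K + avoid i K - (m H + avoid i H) * avoid i K) = f H G (\<lambda>K. m K + (- m H) * avoid i K)"
      using False by (simp add: avoid_def algebra_simps if_distrib cong: if_cong)
    also have "\<dots> = f H G (\<lambda>K. m K + (- m H) * avoid (b H) K)"
      by (rule compatible_shift[OF hi[OF H] i' b[OF H]])
    finally show ?thesis by simp
  next
    case True
    then have i': "i \<in> H - F" using i by auto
    have "step_diff H h (\<lambda>K. m K + avoid i K) =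
       qvar1 * f F H (\<lambda>K. m K + avoid i K - (m H + avoid i H) * contain i K) *
       f H G (\<lambda>K. m K + avoid i K - (m H + avoid i H) * avoid (b H) K)"
      by (rule h_diff[OF H i' b[OF H]])
    also have "(\<lambda>K. m K + avoid i K - (m H + avoid i H) * contain i K) =
        (\<lambda>K. (m K - m H) + (m H + 1) * avoid i K)"
      using True by (auto simp: avoid_def contain_def)
    also have "f F H \<dots> = f F H (\<lambda>K. (m K - m H) + (m H + 1) * avoid (a H) K)"
      by (rule compatible_shift[OF lo[OF H] i' a[OF H]])
    also have "(\<lambda>K. (m K - m H) + (m H + 1) * avoid (a H) K) = (\<lambda>K. m K - m H * contain (a H) K + avoid (a H) K)"
      by (auto simp: avoid_def contain_def)
    also have "f H G (\<lambda>K. m K + avoid i K - (m H + avoid i H) * avoid (b H) K) = f H G (\<lambda>K. m K - m H * avoid (b H) K)"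
      by (rule hi_cong[OF H]) (use True in \<open>auto simp: avoid_def\<close>)
    finally show ?thesis .
  qed
  have h_shift: "h (\<lambda>K. m K + avoid i K) = h (\<lambda>K. m K + avoid j K)" if ij: "i \<in> G - F" "j \<in> G - F" for i j m
  proof -
    define D where "D m = h (\<lambda>K. m K + avoid i K) - h (\<lambda>K. m K + avoid j K)" for m
    have upd: "(\<lambda>K. (m(H := m H + 1)) K + avoid e K) = (\<lambda>K. m K + avoid e K)(H := m H + avoid e H + 1)"
      for m H and e :: 'a by auto
    have "D m = D (\<lambda>_. 0)"
    proof (rule diff_zero_imp_const[OF finP])
      show "depends_on P D"
        unfolding depends_on_def
      proof (intro allI impI)
        fix m m' :: "'a set \<Rightarrow> int" assume "\<forall>K\<in>P. m K = m' K"
        then have "h (\<lambda>K. m K + avoid e K) = h (\<lambda>K. m' K + avoid e K)" for e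
          by (intro depends_onD[OF h(1)]) simp
        then show "D m = D m'" by (simp add: D_def)
      qed
      fix H m assume H: "H \<in> P"
      have "step_diff H D m = step_diff H h (\<lambda>K. m K + avoid i K) - step_diff H h (\<lambda>K. m K + avoid j K)"
        unfolding step_diff_def D_def upd by simp
      then show "step_diff H D m = 0" using diff_avoid[OF H ij(1)] diff_avoid[OF H ij(2)] by simp
    qed
    then show ?thesis using h_avoid ij by (simp add: D_def)
  qed
  show ?thesis
    unfolding compatible_def P_def[symmetric]
    by (intro exI[of _ h] conjI ballI allI h(1,2) h_avoid h_shift h_diff)
qed

text \<open>Recursion on \<open>card (G - F)\<close>: the step from \<open>n\<close> to
  \<open>Suc n\<close> changes only pairs of gap exactly \<open>n\<close>, and
  \<open>compatible_cong\<close> carries compatibility over to the new family.\<close>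

lemma compatible_family_exists:
  obtains f where "\<And>F G. F \<in> L \<Longrightarrow> G \<in> L \<Longrightarrow> F \<subset> G \<Longrightarrow> compatible f F G (f F G)"
proof -
  define good where "good n f \<longleftrightarrow>
    (\<forall>F\<in>L. \<forall>G\<in>L. F \<subset> G \<longrightarrow> card (G - F) < n \<longrightarrow> compatible f F G (f F G))" for n f
  have ex: "\<exists>f. good n f" for n
  proof (induction n)
    case 0
    show ?case by (simp add: good_def)
  next
    case (Suc n)
    then obtain f where f: "good n f" by (elim exE)
    have fD: "compatible f F G (f F G)" if "F \<in> L" "G \<in> L" "F \<subset> G" "card (G - F) < n" for F G
      using f[unfolded good_def, THEN bspec, OF that(1), THEN bspec, OF that(2)] that(3,4) by (elim impE)
    define f' where "f' F G = (if card (G - F) = n then SOME h. compatible f F G h else f F G)" for F G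
    have less: "card (G' - F') < card (G - F)"
      if "G \<in> L" "F \<subseteq> F'" "F' \<subset> G'" "G' \<subseteq> G" "F \<noteq> F' \<or> G \<noteq> G'" for F F' G G'
    proof (rule psubset_card_mono)
      show "finite (G - F)" using finite_flat[OF that(1)] by simp
      show "G' - F' \<subset> G - F" using that(2-5) by blast
    qed
    have "compatible f' F G (f' F G)" if FG: "F \<in> L" "G \<in> L" "F \<subset> G" and n: "card (G - F) < Suc n" for F G
    proof -
      have fG: "compatible f F G (f' F G)"
      proof (cases "card (G - F) = n")
        case True
        have "\<exists>h. compatible f F G h"
          using FG
        proof (rule compatible_exists)
          fix F' G' assume *: "F' \<in> L" "G' \<in> L" "F \<subseteq> F'" "F' \<subset> G'" "G' \<subseteq> G" "F \<noteq> F' \<or> G \<noteq> G'"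
          show "compatible f F' G' (f F' G')"
            using less[OF FG(2) *(3-6)] True by (intro fD *) simp
        qed
        then have "compatible f F G (SOME h. compatible f F G h)" by (rule someI_ex)
        then show ?thesis using True by (simp only: f'_def if_True simp_thms)
      next
        case False
        with n have "card (G - F) < n" by simp
        with FG have "compatible f F G (f F G)" by (rule fD)
        then show ?thesis using False by (simp only: f'_def if_False)
      qed
      have "f F H = f' F H \<and> f H G = f' H G" if H: "H \<in> open_interval F G" for H
      proof -
        have "card (H - F) < card (G - F)" "card (G - H) < card (G - F)"
          using H by (auto intro!: less[OF FG(2)] simp: open_interval_def)
        then show ?thesis using n by (simp only: f'_def) simp
      qed
      then have "compatible f F G (f' F G) \<longleftrightarrow> compatible f' F G (f' F G)" by (rule compatible_cong)
      with fG show ?thesis by (rule iffD1[rotated])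
    qed
    then have "good (Suc n) f'" unfolding good_def by (intro ballI impI)
    then show ?case by (rule exI[of "good (Suc n)" f'])
  qed
  from ex[of "Suc (card (\<Union>L))"] obtain f where f: "good (Suc (card (\<Union>L))) f" by (elim exE)
  show ?thesis
  proof (rule that)
    fix F G assume FG: "F \<in> L" "G \<in> L" "F \<subset> G"
    have "card (G - F) \<le> card (\<Union>L)"
      using FG finite_L finite_flat by (intro card_mono) auto
    then have "card (G - F) < Suc (card (\<Union>L))" by simp
    with f[unfolded good_def, THEN bspec, OF FG(1), THEN bspec, OF FG(2)] FG(3)
    show "compatible f F G (f F G)" by (elim impE)
  qed
qed

end

section \<open>Polynomials acting by difference operators\<close>

definition linear_extension :: "('k \<Rightarrow> 'b::comm_ring_1) \<Rightarrow> ('k \<Rightarrow>\<^sub>0 int) \<Rightarrow> 'b" where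
  "linear_extension c p = (\<Sum>a\<in>Poly_Mapping.keys p. of_int (Poly_Mapping.lookup p a) * c a)"

lemma linear_extension_superset:
  assumes "finite A" "Poly_Mapping.keys p \<subseteq> A"
  shows "linear_extension c p = (\<Sum>a\<in>A. of_int (Poly_Mapping.lookup p a) * c a)"
  unfolding linear_extension_def using assms
  by (intro sum.mono_neutral_left) (auto simp: in_keys_iff)

lemma linear_extension_add: "linear_extension c (p + q) = linear_extension c p + linear_extension c q"
proof -
  let ?A = "Poly_Mapping.keys p \<union> Poly_Mapping.keys q"
  have "linear_extension c (p + q) = (\<Sum>a\<in>?A. of_int (Poly_Mapping.lookup (p + q) a) * c a)"
    using keys_add[of p q] by (intro linear_extension_superset) auto
  also have "\<dots> = (\<Sum>a\<in>?A. of_int (Poly_Mapping.lookup p a) * c a) + (\<Sum>a\<in>?A. of_int (Poly_Mapping.lookup q a) * c a)"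
    by (simp add: lookup_add sum.distrib distrib_right)
  also have "\<dots> = linear_extension c p + linear_extension c q"
    by (simp add: linear_extension_superset[of ?A])
  finally show ?thesis .
qed

lemma linear_extension_uminus: "linear_extension c (- p) = - linear_extension c p"
  by (simp add: linear_extension_def sum_negf)

lemma linear_extension_diff: "linear_extension c (p - q) = linear_extension c p - linear_extension c q"
  using linear_extension_add[of c p "- q"] by (simp add: linear_extension_uminus)

lemma linear_extension_zero [simp]: "linear_extension c 0 = 0"
  by (simp add: linear_extension_def)

lemma linear_extension_single: "linear_extension c (Poly_Mapping.single a x) = of_int x * c a"
  by (simp add: linear_extension_def)

lemma poly_mapping_additive_induct [case_names zero single add]:
  fixes p :: "'k \<Rightarrow>\<^sub>0 'b::comm_monoid_add"
  assumes "P 0" and "\<And>a x. P (Poly_Mapping.single a x)" and "\<And>p q. P p \<Longrightarrow> P q \<Longrightarrow> P (p + q)"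
  shows "P p"
proof (induction p rule: update_induct)
  case (update p a x)
  have "Poly_Mapping.update a x p = p + Poly_Mapping.single a x"
    using update(1) by (intro poly_mapping_eqI) (auto simp: lookup_update lookup_add lookup_single in_keys_iff)
  then show ?case using assms(2,3) update(3) by simp
qed (rule assms(1))

text \<open>As a multiset, a monomial can be fed to \<open>fold_mset\<close>, which applies one of
  the commuting difference operators per factor, with multiplicity.\<close>

definition exponent_mset :: "('v \<Rightarrow>\<^sub>0 nat) \<Rightarrow> 'v multiset" where
  "exponent_mset a = Abs_multiset (Poly_Mapping.lookup a)"

lemma count_exponent_mset: "count (exponent_mset a) v = Poly_Mapping.lookup a v"
  unfolding exponent_mset_def by (subst count_Abs_multiset) (simp_all add: finite_lookup)

lemma exponent_mset_add: "exponent_mset (a + b) = exponent_mset a + exponent_mset b"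
  by (intro multiset_eqI) (simp add: count_exponent_mset lookup_add)

lemma exponent_mset_zero [simp]: "exponent_mset 0 = {#}"
  by (intro multiset_eqI) (simp add: count_exponent_mset)

lemma exponent_mset_single [simp]: "exponent_mset (Poly_Mapping.single v 1) = {#v#}"
  by (intro multiset_eqI) (simp add: count_exponent_mset lookup_single when_def)

interpretation step_diff: comp_fun_commute step_diff
proof
  fix H K :: 'v
  show "step_diff K \<circ> step_diff H = step_diff H \<circ> (step_diff K :: (('v \<Rightarrow> int) \<Rightarrow> 'b::ab_group_add) \<Rightarrow> _)"
    by (cases "H = K") (auto simp: fun_eq_iff step_diff_def fun_upd_twist algebra_simps)
qed

text \<open>A variable acts on functions by \<^const>\<open>step_diff\<close>, so that \<open>1 - mvar H\<close> shifts the exponent at \<open>H\<close>.\<close>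

definition act :: "(('v \<Rightarrow> int) \<Rightarrow> 'b::comm_ring_1) \<Rightarrow> ('v \<Rightarrow> int) \<Rightarrow> (('v \<Rightarrow>\<^sub>0 nat) \<Rightarrow>\<^sub>0 int) \<Rightarrow> 'b" where
  "act f m = linear_extension (\<lambda>a. fold_mset step_diff f (exponent_mset a) m)"

lemmas act_add = linear_extension_add[of "\<lambda>a. fold_mset step_diff f (exponent_mset a) m" for f m, folded act_def]
lemmas act_diff = linear_extension_diff[of "\<lambda>a. fold_mset step_diff f (exponent_mset a) m" for f m, folded act_def]
lemmas act_zero = linear_extension_zero[of "\<lambda>a. fold_mset step_diff f (exponent_mset a) m" for f m, folded act_def]
lemmas act_single = linear_extension_single[of "\<lambda>a. fold_mset step_diff f (exponent_mset a) m" for f m, folded act_def]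

lemma act_one: "act f m 1 = f m"
proof -
  have "act f m (Poly_Mapping.single 0 1) = f m" by (simp only: act_single) simp
  then show ?thesis by simp
qed

lemma act_single_mult:
  "act f m (Poly_Mapping.single b x * p) = of_int x * act (fold_mset step_diff f (exponent_mset b)) m p"
proof (induction p rule: poly_mapping_additive_induct)
  case zero
  show ?case by (simp add: act_zero)
next
  case (single a y)
  show ?case by (simp add: mult_single act_single exponent_mset_add)
next
  case (add p q)
  then show ?case by (simp add: distrib_left act_add)
qed

lemma act_mvar_mult: "act f m (mvar H * p) = act (step_diff H f) m p"
  unfolding mvar_def act_single_mult by (simp only: exponent_mset_single fold_mset_single of_int_1 mult_1)

text \<open>Since the operators commute, the extra one can be taken outside the fold, where it
  becomes a difference of two base points.\<close>

lemma act_difference: "act (step_diff H f) m p = act f m p - act f (m(H := m H + 1)) p"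
proof (induction p rule: poly_mapping_additive_induct)
  case zero
  show ?case by (simp add: act_zero)
next
  case (single a y)
  have "fold_mset step_diff (step_diff H f) (exponent_mset a) m = step_diff H (fold_mset step_diff f (exponent_mset a)) m"
    by (simp add: step_diff.fold_mset_fun_left_comm)
  then show ?case by (simp only: act_single step_diff_def[of H "fold_mset step_diff f (exponent_mset a)" m] right_diff_distrib)
next
  case (add p q)
  then show ?case by (simp add: act_add)
qed

text \<open>Multiplication by a variable turns into a difference of values at neighbouring base
  points, so vanishing is assumed at every \<open>m\<close> and not just at 0.\<close>

lemma act_mult_zero:
  assumes "\<And>m. act f m p = 0"
  shows "act f m (r * p) = 0"
proof (induction r arbitrary: m rule: poly_mapping_additive_induct)
  case zero
  show ?case by (simp add: act_zero)
next
  case (single b x)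
  have "act (fold_mset step_diff f B) m p = 0" for B m
  proof (induction B arbitrary: m)
    case empty
    show ?case by (simp add: assms)
  next
    case (add H B)
    then show ?case by (simp add: act_difference)
  qed
  then show ?case by (simp add: act_single_mult)
next
  case (add r s)
  then show ?case by (simp add: distrib_right act_add)
qed

lemma act_prod_one_minus_mvar:
  assumes "finite S"
  shows "act f m (\<Prod>H\<in>S. 1 - mvar H) = f (\<lambda>K. m K + (if K \<in> S then 1 else 0))"
  using assms
proof (induction S arbitrary: m rule: finite_induct)
  case empty
  show ?case by (simp add: act_one)
next
  case (insert H S)
  have "act f m (\<Prod>H\<in>insert H S. 1 - mvar H) =
      act f m (\<Prod>H\<in>S. 1 - mvar H) - act f m (mvar H * (\<Prod>H\<in>S. 1 - mvar H))"
    using insert by (simp add: left_diff_distrib act_diff)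
  also have "\<dots> = act f (m(H := m H + 1)) (\<Prod>H\<in>S. 1 - mvar H)"
    by (simp add: act_mvar_mult act_difference)
  also have "\<dots> = f (\<lambda>K. (m(H := m H + 1)) K + (if K \<in> S then 1 else 0))"
    by (rule insert.IH)
  also have "(\<lambda>K. (m(H := m H + 1)) K + (if K \<in> S then 1 else 0)) =
      (\<lambda>K. m K + (if K \<in> insert H S then 1 else 0))"
    using insert by auto
  finally show ?case .
qed

text \<open>Expanding the product only raises exponents in \<open>T\<close>, so every evaluation
  point remains supported in \<open>S\<close>. In \<open>act_flag\<close> the difference formula
  factors in the required way only on such points.\<close>

lemma act_prod_mvar_cong:
  assumes "finite T" "T \<subseteq> S"
    and eq: "\<And>m. (\<forall>K. K \<notin> S \<longrightarrow> m K = 0) \<Longrightarrow> g m = c * g' m"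
    and m: "\<forall>K. K \<notin> S \<longrightarrow> m K = 0"
  shows "act g m (\<Prod>K\<in>T. mvar K) = c * act g' m (\<Prod>K\<in>T. mvar K)"
  using assms(1,2) m
proof (induction T arbitrary: m rule: finite_induct)
  case empty
  then show ?case by (simp add: act_one eq)
next
  case (insert H T)
  have IH: "act g m (\<Prod>K\<in>T. mvar K) = c * act g' m (\<Prod>K\<in>T. mvar K)"
      "act g (m(H := m H + 1)) (\<Prod>K\<in>T. mvar K) = c * act g' (m(H := m H + 1)) (\<Prod>K\<in>T. mvar K)"
    using insert.prems by (auto intro!: insert.IH)
  show ?case
    using insert.hyps by (simp add: act_mvar_mult act_difference IH right_diff_distrib)
qed

section \<open>Flats and minors of a matroid\<close>

context matroid
begin

lemma finite_indep: "I \<in> indeps M \<Longrightarrow> finite I"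
  using indeps_subset finite_ground by (meson PowD finite_subset subsetD)

lemma finite_indeps: "finite (indeps M)"
  using indeps_subset finite_ground by (meson finite_Pow_iff finite_subset)

lemma card_le_rank:
  assumes "I \<in> indeps M" "I \<subseteq> A"
  shows "card I \<le> rank M A"
  unfolding rank_def using assms finite_indeps by (intro Max_ge) auto

lemma rank_attained: "\<exists>I\<in>indeps M. I \<subseteq> A \<and> card I = rank M A"
proof -
  have "rank M A \<in> card ` {I \<in> indeps M. I \<subseteq> A}"
    unfolding rank_def using finite_indeps empty_indep by (intro Max_in) auto
  then show ?thesis by auto
qed

lemma rank_subset_mono: "A \<subseteq> B \<Longrightarrow> rank M A \<le> rank M B"
  using rank_attained[of A] card_le_rank[of _ B] by (metis order_trans)

lemma card_basis:
  assumes "basis_of M A B"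
  shows "card B = rank M A"
proof (rule antisym)
  show "card B \<le> rank M A" using assms by (auto simp: basis_of_def intro: card_le_rank)
  obtain I where I: "I \<in> indeps M" "I \<subseteq> A" "card I = rank M A" using rank_attained by blast
  show "rank M A \<le> card B"
  proof (rule ccontr)
    assume "\<not> rank M A \<le> card B"
    then have "card B < card I" using I by simp
    then obtain e where "e \<in> I - B" "insert e B \<in> indeps M"
      using augment[of B I] I assms by (auto simp: basis_of_def)
    then show False using I assms by (auto simp: basis_of_def)
  qed
qed

lemma basis_extends:
  assumes "I \<in> indeps M" "I \<subseteq> A"
  obtains B where "basis_of M A B" "I \<subseteq> B"
proof -
  let ?S = "{J \<in> indeps M. J \<subseteq> A}"
  have "finite ?S" using finite_indeps by simp
  moreover have "I \<in> ?S" using assms by simp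
  ultimately have "\<exists>B\<in>?S. I \<subseteq> B \<and> (\<forall>J\<in>?S. B \<subseteq> J \<longrightarrow> B = J)"
    by (rule finite_has_maximal2)
  then obtain B where B: "B \<in> ?S" "I \<subseteq> B" and max: "\<forall>J\<in>?S. B \<subseteq> J \<longrightarrow> B = J"
    by (elim bexE conjE)
  have "insert e B \<notin> indeps M" if "e \<in> A - B" for e
  proof
    assume "insert e B \<in> indeps M"
    then have "B = insert e B" using max[THEN bspec, of "insert e B"] B that by blast
    then show False using that by auto
  qed
  then have "basis_of M A B" using B by (simp add: basis_of_def)
  then show ?thesis using B(2) by (rule that)
qed

lemma basis_exists: obtains B where "basis_of M A B"
proof -
  obtain B where "basis_of M A B" by (rule basis_extends[OF empty_indep empty_subsetI])
  then show ?thesis by (rule that)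
qed

lemma rank_insert:
  assumes B: "basis_of M A B" and e: "e \<notin> A"
  shows "rank M (insert e A) = (if insert e B \<in> indeps M then Suc (rank M A) else rank M A)"
proof (cases "insert e B \<in> indeps M")
  case True
  have "insert e' (insert e B) \<notin> indeps M" if "e' \<in> A - B" for e'
    using B that indep_mono[of "insert e' (insert e B)" "insert e' B"] by (auto simp: basis_of_def)
  then have "basis_of M (insert e A) (insert e B)"
    using True B by (auto simp: basis_of_def)
  moreover have "finite B" "e \<notin> B" using B e finite_indep by (auto simp: basis_of_def)
  ultimately show ?thesis using True card_basis[OF B] card_basis[of "insert e A" "insert e B"] by simp
next
  case False
  then have "basis_of M (insert e A) B" using B by (auto simp: basis_of_def)
  then show ?thesis using False card_basis[OF B] card_basis[of "insert e A" B] by simp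
qed

text \<open>Diminishing returns of the rank: a basis of \<open>A\<close> extends to one of
  \<open>A'\<close>, and an element that extends the larger basis also extends the smaller.\<close>

lemma rank_less_insert_antimono:
  assumes "A \<subseteq> A'" "e \<notin> A'" "rank M A' < rank M (insert e A')"
  shows "rank M A < rank M (insert e A)"
proof -
  obtain B where B: "basis_of M A B" by (rule basis_exists)
  then have "B \<in> indeps M" "B \<subseteq> A'" using assms(1) by (auto simp: basis_of_def)
  then obtain B' where B': "basis_of M A' B'" "B \<subseteq> B'" by (rule basis_extends)
  have "insert e B' \<in> indeps M" using rank_insert[OF B'(1) assms(2)] assms(3) by (auto split: if_splits)
  then have "insert e B \<in> indeps M" by (rule indep_mono) (use B' in auto)
  moreover have "e \<notin> A" using assms by auto
  ultimately show ?thesis using rank_insert[OF B] by simp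
qed

lemma flats_iff_basis:
  assumes "F \<subseteq> ground M" "basis_of M F B"
  shows "F \<in> flats M \<longleftrightarrow> (\<forall>e\<in>ground M - F. insert e B \<in> indeps M)"
proof -
  have "rank M F < rank M (insert e F) \<longleftrightarrow> insert e B \<in> indeps M" if "e \<in> ground M - F" for e
    using rank_insert[OF assms(2)] that by simp
  then show ?thesis using assms(1) by (simp add: flats_def)
qed

lemma flat_subset_ground: "F \<in> flats M \<Longrightarrow> F \<subseteq> ground M"
  by (simp add: flats_def)

lemma rank_strict_flats:
  assumes "F \<in> flats M" "G \<in> flats M" "F \<subset> G"
  shows "rank M F < rank M G"
proof -
  obtain e where e: "e \<in> G - F" using assms by auto
  then have "rank M F < rank M (insert e F)" using assms by (auto simp: flats_def)
  also have "\<dots> \<le> rank M G" using e assms by (intro rank_subset_mono) auto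
  finally show ?thesis .
qed

lemma flat_join:
  assumes F: "F \<in> flats M" and e: "e \<in> ground M - F"
  shows "\<exists>K\<in>flats M. insert e F \<subseteq> K \<and> rank M K = Suc (rank M F) \<and>
    (\<forall>H\<in>flats M. insert e F \<subseteq> H \<longrightarrow> K \<subseteq> H)"
proof -
  obtain B where B: "basis_of M F B" by (rule basis_exists)
  have FE: "F \<subseteq> ground M" by (rule flat_subset_ground[OF F])
  have B': "insert e B \<in> indeps M" using flats_iff_basis[OF FE B] F e by auto
  \<comment> \<open>The closure of \<open>insert e B\<close>, phrased by independence so that
    \<open>insert e B\<close> is visibly a basis of it.\<close>
  define K where "K = {x \<in> ground M. x \<in> insert e B \<or> insert x (insert e B) \<notin> indeps M}"
  have KE: "K \<subseteq> ground M" by (auto simp: K_def)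
  have BF: "B \<subseteq> F" using B by (simp add: basis_of_def)
  have basis: "basis_of M K (insert e B)"
    using B' BF FE e by (auto simp: basis_of_def K_def)
  have "K \<in> flats M" unfolding flats_iff_basis[OF KE basis] by (auto simp: K_def)
  moreover have "insert e F \<subseteq> K"
  proof -
    have "x \<in> B \<or> insert x (insert e B) \<notin> indeps M" if "x \<in> F" for x
      using B that indep_mono[of "insert x (insert e B)" "insert x B"] by (auto simp: basis_of_def)
    then show ?thesis using e FE by (auto simp: K_def)
  qed
  moreover have "rank M K = Suc (rank M F)"
  proof -
    have "e \<notin> B" "finite B" using BF e finite_indep[OF B'] by auto
    then show ?thesis using card_basis[OF basis] card_basis[OF B] by simp
  qed
  moreover have "K \<subseteq> H" if H: "H \<in> flats M" "insert e F \<subseteq> H" for H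
  proof
    fix x assume x: "x \<in> K"
    have "insert e B \<subseteq> H" using H(2) BF by auto
    with B' obtain C where C: "basis_of M H C" "insert e B \<subseteq> C" by (rule basis_extends)
    show "x \<in> H"
    proof (rule ccontr)
      assume xH: "x \<notin> H"
      then have "insert x C \<in> indeps M"
        using flats_iff_basis[OF flat_subset_ground[OF H(1)] C(1)] H(1) x by (auto simp: K_def)
      then have "insert x (insert e B) \<in> indeps M" by (rule indep_mono) (use C in auto)
      then show False using x xH H(2) BF by (auto simp: K_def)
    qed
  qed
  ultimately show ?thesis by blast
qed

sublocale ranked_flats "flats M" "rank M"
proof
  have sub: "flats M \<subseteq> Pow (ground M)" by (auto simp: flats_def)
  show "finite (flats M)" using sub finite_ground by (meson finite_Pow_iff finite_subset)
  show "finite F" if "F \<in> flats M" for F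
    using flat_subset_ground[OF that] finite_ground by (rule finite_subset)
  show "\<exists>K\<in>flats M. insert e F \<subseteq> K \<and> rank M K = Suc (rank M F) \<and> (\<forall>H\<in>flats M. insert e F \<subseteq> H \<longrightarrow> K \<subseteq> H)"
    if "F \<in> flats M" "G \<in> flats M" "F \<subseteq> G" "e \<in> G - F" for F G e
    using that flat_subset_ground[OF that(2)] by (intro flat_join) auto
qed (rule rank_strict_flats)

section \<open>Minors as intervals of flats\<close>

context
  fixes F G N
  assumes F: "F \<in> flats M" and G: "G \<in> flats M" and FG: "F \<subseteq> G"
  defines "N \<equiv> contract_matroid (restrict_matroid M G) F"
begin

lemma ground_minor: "ground N = G - F"
  by (simp add: N_def contract_matroid_def restrict_matroid_def)

lemma indeps_minor: "I \<in> indeps N \<longleftrightarrow> I \<subseteq> G - F \<and> (\<exists>B. basis_of M F B \<and> I \<union> B \<in> indeps M)"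
proof -
  have restrict: "ground (restrict_matroid M G) = G" "indeps (restrict_matroid M G) = {I \<in> indeps M. I \<subseteq> G}"
    by (simp_all add: restrict_matroid_def)
  have basis: "basis_of (restrict_matroid M G) F B \<longleftrightarrow> basis_of M F B" for B
    using FG by (auto simp: basis_of_def restrict)
  have "I \<in> indeps N \<longleftrightarrow> I \<subseteq> G - F \<and> (\<exists>B. basis_of M F B \<and> I \<union> B \<in> indeps (restrict_matroid M G))"
    by (simp add: N_def contract_matroid_def restrict(1) basis)
  moreover have "I \<union> B \<in> indeps (restrict_matroid M G) \<longleftrightarrow> I \<union> B \<in> indeps M"
    if "I \<subseteq> G - F" "basis_of M F B" for B
    using that FG by (auto simp: basis_of_def restrict(2))
  ultimately show ?thesis by blast
qed

lemma rank_minor: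
  assumes A: "A \<subseteq> G - F"
  shows "rank N A = rank M (A \<union> F) - rank M F"
  unfolding rank_def[of N]
proof (rule Max_eqI)
  have "{I \<in> indeps N. I \<subseteq> A} \<subseteq> Pow (ground M)"
    using A flat_subset_ground[OF G] by auto
  then show "finite (card ` {I \<in> indeps N. I \<subseteq> A})"
    using finite_ground by (meson finite_Pow_iff finite_imageI finite_subset)
next
  fix n assume "n \<in> card ` {I \<in> indeps N. I \<subseteq> A}"
  then obtain I B where I: "n = card I" "I \<subseteq> A" "basis_of M F B" "I \<union> B \<in> indeps M"
    by (auto simp: indeps_minor)
  have "B \<subseteq> F" using I by (simp add: basis_of_def)
  then have "card (I \<union> B) = card I + card B"
    using finite_indep[OF I(4)] A I(2) by (intro card_Un_disjoint) auto
  moreover have "card (I \<union> B) \<le> rank M (A \<union> F)"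
    using I \<open>B \<subseteq> F\<close> by (intro card_le_rank) auto
  ultimately show "n \<le> rank M (A \<union> F) - rank M F"
    using I(1) card_basis[OF I(3)] by simp
next
  obtain B where B: "basis_of M F B" by (rule basis_exists)
  then have "B \<in> indeps M" "B \<subseteq> A \<union> F" by (auto simp: basis_of_def)
  then obtain C where C: "basis_of M (A \<union> F) C" "B \<subseteq> C" by (rule basis_extends)
  \<comment> \<open>By maximality of \<open>B\<close> in \<open>F\<close>, the extension
    \<open>C\<close> gains no further elements of \<open>F\<close>, so \<open>C - B\<close> lies in
    \<open>A\<close>.\<close>
  have "C \<inter> F \<subseteq> B"
  proof
    fix e assume e: "e \<in> C \<inter> F"
    have "insert e B \<in> indeps M"
      using C e by (intro indep_mono[of C "insert e B"]) (auto simp: basis_of_def)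
    then show "e \<in> B" using B e by (auto simp: basis_of_def)
  qed
  then have "C - B \<subseteq> A" "C - B \<union> B = C" using C by (auto simp: basis_of_def)
  then have "C - B \<in> {I \<in> indeps N. I \<subseteq> A}"
    using A B C by (auto simp: indeps_minor basis_of_def intro!: exI[of _ B])
  moreover have "card (C - B) = rank M (A \<union> F) - rank M F"
    using C card_basis[OF C(1)] card_basis[OF B] finite_indep[OF \<open>B \<in> indeps M\<close>]
    by (simp add: card_Diff_subset)
  ultimately show "rank M (A \<union> F) - rank M F \<in> card ` {I \<in> indeps N. I \<subseteq> A}"
    by (metis image_eqI)
qed

lemma flats_minor_iff:
  assumes A: "A \<subseteq> G - F"
  shows "A \<in> flats N \<longleftrightarrow> A \<union> F \<in> flats M"
proof -
  have AG: "A \<union> F \<subseteq> G" using A FG by auto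
  have "rank N A < rank N (insert e A) \<longleftrightarrow> rank M (A \<union> F) < rank M (insert e (A \<union> F))"
    if "e \<in> G - F" for e
  proof -
    have "rank M F \<le> rank M (A \<union> F)" by (rule rank_subset_mono) simp
    then show ?thesis using that A rank_minor[OF A] rank_minor[of "insert e A"] by auto
  qed
  then have "A \<in> flats N \<longleftrightarrow> (\<forall>e\<in>G - (A \<union> F). rank M (A \<union> F) < rank M (insert e (A \<union> F)))"
    using A by (auto simp: flats_def ground_minor)
  \<comment> \<open>Flatness in \<open>M\<close> also concerns elements outside \<open>G\<close>;
    for these it is inherited from the flat \<open>G\<close>.\<close>
  moreover have "rank M (A \<union> F) < rank M (insert e (A \<union> F))" if "e \<in> ground M - G" for e
    using that G by (intro rank_less_insert_antimono[OF AG]) (auto simp: flats_def)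
  ultimately show ?thesis
    using AG flat_subset_ground[OF G] unfolding flats_def[of M] by blast
qed

lemma flats_minor: "flats N = (\<lambda>H. H - F) ` interval F G"
proof (intro equalityI subsetI)
  fix A assume A: "A \<in> flats N"
  then have AG: "A \<subseteq> G - F" by (auto simp: flats_def ground_minor)
  then have "A \<union> F \<in> interval F G" using A flats_minor_iff[OF AG] FG by (auto simp: interval_def)
  moreover have "A = (A \<union> F) - F" using AG by auto
  ultimately show "A \<in> (\<lambda>H. H - F) ` interval F G" by blast
next
  fix A assume "A \<in> (\<lambda>H. H - F) ` interval F G"
  then obtain H where H: "A = H - F" "H \<in> interval F G" by auto
  then have "A \<subseteq> G - F" "A \<union> F = H" by (auto simp: interval_def)
  then show "A \<in> flats N" using flats_minor_iff[of A] H by (auto simp: interval_def)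
qed

lemma inj_minor: "inj_on (\<lambda>H. H - F) (interval F G)"
  by (rule inj_on_inverseI[where g = "\<lambda>A. A \<union> F"]) (auto simp: interval_def)

lemma mobius_minor:
  "H \<in> interval F G \<Longrightarrow> mobius (flats N) {} (H - F) = mobius (flats M) F H"
proof (induction "card H" arbitrary: H rule: less_induct)
  case less
  have H: "H \<in> flats M" "F \<subseteq> H" "H \<subseteq> G" using less.prems by (auto simp: interval_def)
  show ?case
  proof (cases "F = H")
    case True
    then show ?thesis by (simp add: mobius.simps[of "flats N" "{}" "{}"])
  next
    case False
    let ?I = "{K \<in> flats M. F \<subseteq> K \<and> K \<subset> H}"
    have img: "{K \<in> flats N. {} \<subseteq> K \<and> K \<subset> H - F} = (\<lambda>K. K - F) ` ?I"
    proof (intro equalityI subsetI)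
      fix A assume A: "A \<in> {K \<in> flats N. {} \<subseteq> K \<and> K \<subset> H - F}"
      then obtain K where K: "A = K - F" "K \<in> interval F G" unfolding flats_minor by blast
      then have "K \<subset> H" using A H(2) by (auto simp: interval_def)
      then show "A \<in> (\<lambda>K. K - F) ` ?I" using K by (auto simp: interval_def)
    next
      fix A assume "A \<in> (\<lambda>K. K - F) ` ?I"
      then obtain K where K: "A = K - F" "K \<in> ?I" by blast
      then have "K \<in> interval F G" "K - F \<subset> H - F" using H by (auto simp: interval_def)
      then show "A \<in> {K \<in> flats N. {} \<subseteq> K \<and> K \<subset> H - F}"
        using K(1) unfolding flats_minor by blast
    qed
    have sub: "?I \<subseteq> interval F G" using H by (auto simp: interval_def)
    have "(\<Sum>K\<in>{K \<in> flats N. {} \<subseteq> K \<and> K \<subset> H - F}. mobius (flats N) {} K) =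
        (\<Sum>K\<in>?I. mobius (flats N) {} (K - F))"
      unfolding img by (subst sum.reindex[OF inj_on_subset[OF inj_minor sub]]) simp
    also have "\<dots> = (\<Sum>K\<in>?I. mobius (flats M) F K)"
    proof (rule sum.cong[OF refl])
      fix K assume K: "K \<in> ?I"
      then have "card K < card H" using finite_flat[OF H(1)] by (auto intro: psubset_card_mono)
      then show "mobius (flats N) {} (K - F) = mobius (flats M) F K"
        using K sub by (intro less(1)) auto
    qed
    finally have eq: "(\<Sum>K\<in>{K \<in> flats N. {} \<subseteq> K \<and> K \<subset> H - F}. mobius (flats N) {} K) =
        (\<Sum>K\<in>?I. mobius (flats M) F K)" .
    have "{} \<noteq> H - F" "finite (H - F)" "{} \<subset> H - F" "finite H" "F \<subset> H"
      using False H finite_flat[OF H(1)] by auto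
    then show ?thesis
      using False eq mobius.simps[of "flats N" "{}" "H - F"] mobius.simps[of "flats M" F H] by simp
  qed
qed

lemma pcompose_char_poly_minor: "pcompose (char_poly N) qvar = chi F G"
proof -
  have monom: "pcompose (monom c n) qvar = of_int c * qvar ^ n" for c n
  proof -
    have "pcompose ([:0, 1:] ^ n) qvar = qvar ^ n"
      by (induction n) (simp_all only: power_0 power_Suc pcompose_1 pcompose_mult, simp add: pcompose_pCons)
    then show ?thesis by (simp add: monom_altdef pcompose_smult of_int_poly)
  qed
  have "char_poly N = (\<Sum>H\<in>interval F G. monom (mobius (flats N) {} (H - F)) (rank N (G - F) - rank N (H - F)))"
    unfolding char_poly_def ground_minor flats_minor by (subst sum.reindex[OF inj_minor]) simp
  also have "\<dots> = (\<Sum>H\<in>interval F G. monom (mobius (flats M) F H) (rank M G - rank M H))"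
  proof (rule sum.cong[OF refl])
    fix H assume H: "H \<in> interval F G"
    then have "H - F \<subseteq> G - F" "H - F \<union> F = H" "G - F \<union> F = G" "rank M F \<le> rank M H"
      using FG by (auto simp: interval_def intro: rank_subset_mono)
    then show "monom (mobius (flats N) {} (H - F)) (rank N (G - F) - rank N (H - F)) =
        monom (mobius (flats M) F H) (rank M G - rank M H)"
      using mobius_minor[OF H] rank_minor[of "H - F"] rank_minor[of "G - F"] by simp
  qed
  finally show ?thesis by (simp only: pcompose_sum monom chi_def)
qed

end

lemma pcompose_flag:
  assumes "sorted_wrt (\<subset>) (F # fs @ [G])" "set (F # fs @ [G]) \<subseteq> flats M"
  shows "pcompose (prod_list (map2 (\<lambda>F G. char_poly (contract_matroid (restrict_matroid M G) F)) (F # fs) (fs @ [G]))) qvar =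
    prod_list (map2 chi (F # fs) (fs @ [G]))"
  using assms
proof (induction fs arbitrary: F)
  case Nil
  then show ?case using pcompose_char_poly_minor[of F G] by simp
next
  case (Cons H fs)
  then have "pcompose (char_poly (contract_matroid (restrict_matroid M H) F)) qvar = chi F H"
    by (intro pcompose_char_poly_minor) auto
  then show ?case using Cons.IH[of H] Cons.prems by (simp add: pcompose_mult)
qed

end

section \<open>Functionals on the K-ring\<close>

context ranked_flats
begin

text \<open>The smallest flat \<open>H\<close> is split off. On exponents supported on the later
  flats the lower factor is \<open>rchi F H\<close> and the upper one is the functional of [H, G];
  the \<open>qvar1\<close> from the difference turns \<open>rchi F H\<close> into
  \<open>chi F H\<close>, and the one in front passes to the rest of the flag.\<close>

lemma act_flag:
  assumes f: "\<And>F G. F \<in> L \<Longrightarrow> G \<in> L \<Longrightarrow> F \<subset> G \<Longrightarrow> compatible f F G (f F G)"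
    and sorted: "sorted_wrt (\<subset>) (F # fs @ [G])" and L: "set (F # fs @ [G]) \<subseteq> L"
  shows "qvar1 * act (f F G) (\<lambda>_. 0) (\<Prod>K\<in>set fs. mvar K) =
    prod_list (map2 chi (F # fs) (fs @ [G]))"
  using sorted L
proof (induction fs arbitrary: F)
  case Nil
  then have FG: "F \<in> L" "G \<in> L" "F \<subset> G" by auto
  then show ?case using compatible_zero[OF f[OF FG]] chi_eq_rchi[OF FG]
    by (simp del: mult_pCons_left add: act_one)
next
  case (Cons H fs)
  then have F: "F \<in> L" and G: "G \<in> L" and H: "H \<in> L" and FH: "F \<subset> H" and HG: "H \<subset> G" and FG: "F \<subset> G"
    and above: "\<And>K. K \<in> set fs \<Longrightarrow> H \<subset> K" by auto
  let ?S = "set fs" and ?P = "\<Prod>K\<in>set fs. mvar K"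
  obtain i j where i: "i \<in> H - F" and j: "j \<in> G - H" using FH HG by auto
  have "act (step_diff H (f F G)) (\<lambda>_. 0) ?P = (qvar1 * rchi F H) * act (f H G) (\<lambda>_. 0) ?P"
  proof (rule act_prod_mvar_cong[where S = ?S])
    fix m :: "'a set \<Rightarrow> int" assume m: "\<forall>K. K \<notin> ?S \<longrightarrow> m K = 0"
    have mH: "m H = 0" using m above by auto
    have "step_diff H (f F G) m = qvar1 * f F H (\<lambda>K. m K - m H * contain i K) *
        f H G (\<lambda>K. m K - m H * avoid j K)"
      using H FH HG by (intro compatible_diff[OF f[OF F G FG] _ i j]) (simp add: open_interval_def)
    also have "f F H (\<lambda>K. m K - m H * contain i K) = f F H (\<lambda>_. 0)"
      using m mH above
      by (intro depends_onD[OF compatible_depends[OF f[OF F H FH]]]) (auto simp: open_interval_def)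
    also have "\<dots> = rchi F H" by (rule compatible_zero[OF f[OF F H FH]])
    finally show "step_diff H (f F G) m = qvar1 * rchi F H * f H G m" by (simp only: mH mult_zero_left diff_zero)
  qed auto
  moreover have "(\<Prod>K\<in>set (H # fs). mvar K) = mvar H * ?P"
  proof -
    have "H \<notin> set fs" using above by auto
    then show ?thesis by simp
  qed
  moreover have "qvar1 * act (f H G) (\<lambda>_. 0) ?P = prod_list (map2 chi (H # fs) (fs @ [G]))"
    using Cons.prems by (intro Cons.IH) auto
  ultimately show ?case
    using chi_eq_rchi[OF F H FH] by (simp del: mult_pCons_left mult_pCons_right add: act_mvar_mult mult.assoc mult.left_commute)
qed

end

lemma (in cring) finsum_int_mult_image:
  fixes c :: "'c \<Rightarrow> int"
  assumes h: "h \<in> ring_hom R S" and S: "cring S" and fin: "finite A"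
    and x: "\<And>a. a \<in> A \<Longrightarrow> x a \<in> carrier R"
  shows "(\<Oplus>\<^bsub>S\<^esub>a\<in>A. [c a] \<cdot>\<^bsub>S\<^esub> h (x a)) = h (\<Oplus>a\<in>A. [c a] \<cdot> x a)"
proof -
  interpret ring_hom_cring R S h
    by (intro ring_hom_cring.intro ring_hom_cring_axioms.intro is_cring S h)
  interpret g: group_hom "add_monoid R" "add_monoid S" h
    by (intro group_hom.intro group_hom_axioms.intro a_group S.a_group)
      (auto simp: hom_def)
  have "h ([c a] \<cdot> x a) = [c a] \<cdot>\<^bsub>S\<^esub> h (x a)" if "a \<in> A" for a
    using g.hom_int_pow[of "x a" "c a"] x[OF that] by (simp add: add_pow_def)
  moreover have "h (\<Oplus>a\<in>A. [c a] \<cdot> x a) = (\<Oplus>\<^bsub>S\<^esub>a\<in>A. (h \<circ> (\<lambda>a. [c a] \<cdot> x a)) a)"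
    using x by (intro hom_finsum) auto
  ultimately show ?thesis
    using x by (simp) (rule S.finsum_cong'; auto)
qed

lemma mpoly_ring_simps:
  "p \<oplus>\<^bsub>mpoly_ring V\<^esub> q = p + q" "p \<otimes>\<^bsub>mpoly_ring V\<^esub> q = p * q"
  "\<zero>\<^bsub>mpoly_ring V\<^esub> = 0" "\<one>\<^bsub>mpoly_ring V\<^esub> = 1"
  by (simp_all add: mpoly_ring_def)

lemma mpoly_ring_finprod:
  assumes "finite A" "\<And>a. a \<in> A \<Longrightarrow> x a \<in> carrier (mpoly_ring V)"
  shows "(\<Otimes>\<^bsub>mpoly_ring V\<^esub>a\<in>A. x a) = (\<Prod>a\<in>A. x a)"
proof -
  interpret cring "mpoly_ring V" by (rule cring_mpoly_ring)
  show ?thesis using assms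
    by (induction A rule: finite_induct) (simp_all add: Pi_def, simp_all add: mpoly_ring_simps)
qed

lemma mpoly_ring_finsum:
  assumes "finite A" "\<And>a. a \<in> A \<Longrightarrow> x a \<in> carrier (mpoly_ring V)"
  shows "(\<Oplus>\<^bsub>mpoly_ring V\<^esub>a\<in>A. x a) = (\<Sum>a\<in>A. x a)"
proof -
  interpret cring "mpoly_ring V" by (rule cring_mpoly_ring)
  show ?thesis using assms
    by (induction A rule: finite_induct) (simp_all add: Pi_def, simp_all add: mpoly_ring_simps)
qed

lemma mpoly_ring_int_mult:
  fixes k :: int
  assumes "x \<in> carrier (mpoly_ring V)"
  shows "[k] \<cdot>\<^bsub>mpoly_ring V\<^esub> x = of_int k * x"
proof -
  interpret cring "mpoly_ring V" by (rule cring_mpoly_ring)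
  have nat: "[n] \<cdot>\<^bsub>mpoly_ring V\<^esub> x = of_nat n * x" for n :: nat
  proof (induction n)
    case 0
    then show ?case by (simp add: add_pow_def nat_pow_def mpoly_ring_simps)
  next
    case (Suc n)
    have "[Suc n] \<cdot>\<^bsub>mpoly_ring V\<^esub> x = [n] \<cdot>\<^bsub>mpoly_ring V\<^esub> x \<oplus>\<^bsub>mpoly_ring V\<^esub> x"
      by (rule add.nat_pow_Suc)
    then show ?case using Suc by (simp add: mpoly_ring_simps distrib_right add.commute)
  qed
  show ?thesis
  proof (cases "k \<ge> 0")
    case True
    then show ?thesis by (simp add: add_pow_int_ge nat)
  next
    case False
    let ?y = "[nat (- k)] \<cdot>\<^bsub>mpoly_ring V\<^esub> x"
    have "?y \<in> carrier (mpoly_ring V)" using assms by simp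
    then have "\<ominus>\<^bsub>mpoly_ring V\<^esub> ?y = - ?y"
      using r_neg[of ?y] by (simp add: mpoly_ring_simps) (metis add_eq_0_iff)
    then show ?thesis using False by (simp add: add_pow_int_lt nat)
  qed
qed

lemma act_int_mult: "act f m (of_int k * p) = of_int k * act f m p"
proof -
  have 1: "act f m (of_nat n * p) = of_nat n * act f m p" for n
    by (induction n) (simp_all add: act_zero act_add distrib_right)
  show ?thesis
  proof (cases k rule: int_cases2)
    case (nonneg n)
    then show ?thesis by (simp add: 1)
  next
    case (nonpos n)
    have "act f m (- (of_nat n * p)) = - act f m (of_nat n * p)"
      using act_diff[of f m 0 "of_nat n * p"] by (simp add: act_zero)
    then show ?thesis using nonpos by (simp add: 1)
  qed
qed

lemma act_sum: "act f m (\<Sum>a\<in>A. p a) = (\<Sum>a\<in>A. act f m (p a))"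
  by (induction A rule: infinite_finite_induct) (simp_all add: act_zero act_add)

lemma ideal_annihilator:
  "ideal {p \<in> carrier (mpoly_ring V). \<forall>m. act f m p = 0} (mpoly_ring V)"
proof -
  interpret cring "mpoly_ring V" by (rule cring_mpoly_ring)
  have neg: "- p \<in> carrier (mpoly_ring V)" if "p \<in> carrier (mpoly_ring V)" for p
    using that by (simp add: mpoly_ring_def)
  have inv: "\<ominus>\<^bsub>mpoly_ring V\<^esub> p = - p" if "p \<in> carrier (mpoly_ring V)" for p
    using r_neg[OF that] by (simp add: mpoly_ring_simps) (metis add_eq_0_iff)
  have uminus: "act f m (- p) = - act f m p" for m p
    using act_diff[of f m 0 p] by (simp add: act_zero)
  show ?thesis
  proof (rule idealI)
    show "subgroup {p \<in> carrier (mpoly_ring V). \<forall>m. act f m p = 0} (add_monoid (mpoly_ring V))"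
    proof (rule add.subgroupI)
      show "{p \<in> carrier (mpoly_ring V). \<forall>m. act f m p = 0} \<noteq> {}"
        using zero_closed by (auto simp: mpoly_ring_simps act_zero)
    next
      fix p assume "p \<in> {p \<in> carrier (mpoly_ring V). \<forall>m. act f m p = 0}"
      then show "\<ominus>\<^bsub>mpoly_ring V\<^esub> p \<in> {p \<in> carrier (mpoly_ring V). \<forall>m. act f m p = 0}"
        using neg inv uminus by auto
    next
      fix p q assume "p \<in> {p \<in> carrier (mpoly_ring V). \<forall>m. act f m p = 0}"
        "q \<in> {p \<in> carrier (mpoly_ring V). \<forall>m. act f m p = 0}"
      then show "p \<oplus>\<^bsub>mpoly_ring V\<^esub> q \<in> {p \<in> carrier (mpoly_ring V). \<forall>m. act f m p = 0}"
        using add.m_closed[of p q] by (simp add: mpoly_ring_simps act_add)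
    qed auto
  next
    fix p r assume pr: "p \<in> {p \<in> carrier (mpoly_ring V). \<forall>m. act f m p = 0}" "r \<in> carrier (mpoly_ring V)"
    have "act f m (r * p) = 0" for m using pr by (intro act_mult_zero) auto
    moreover have "r \<otimes>\<^bsub>mpoly_ring V\<^esub> p \<in> carrier (mpoly_ring V)"
      "p \<otimes>\<^bsub>mpoly_ring V\<^esub> r \<in> carrier (mpoly_ring V)" using pr by auto
    ultimately show "r \<otimes>\<^bsub>mpoly_ring V\<^esub> p \<in> {p \<in> carrier (mpoly_ring V). \<forall>m. act f m p = 0}"
      "p \<otimes>\<^bsub>mpoly_ring V\<^esub> r \<in> {p \<in> carrier (mpoly_ring V). \<forall>m. act f m p = 0}"
      by (simp_all add: mpoly_ring_simps mult.commute)
  qed (rule ring_axioms)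
qed

text \<open>A relation among monomials in the quotient is a polynomial in \<open>K_ideal\<close>.
  The annihilator of \<open>f\<close> is an ideal containing the generators, hence contains that
  polynomial, and evaluation at 0 gives the relation for \<open>g\<close>.\<close>

lemma grothendieck_weightI:
  fixes g :: "'a set list \<Rightarrow> int poly"
  assumes fin: "finite (ground M)"
    and rel: "\<And>p m. p \<in> K_relations M \<Longrightarrow> act f m p = 0"
    and g: "\<And>fs. fs \<in> flags M \<Longrightarrow> act f (\<lambda>_. 0) (\<Prod>F\<in>set fs. mvar F) = g fs"
  shows "grothendieck_weight M g"
  unfolding grothendieck_weight_def
proof (intro allI impI)
  fix c :: "'a set list \<Rightarrow> int"
  let ?R = "mpoly_ring (proper_flats M)"
  let ?x = "\<lambda>fs. \<Prod>F\<in>set fs. mvar F"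
  let ?h = "\<lambda>p. K_ideal M +>\<^bsub>?R\<^esub> p"
  assume zero: "(\<Oplus>\<^bsub>K_ring M\<^esub>fs\<in>flags M. [c fs] \<cdot>\<^bsub>K_ring M\<^esub> K_monomial M fs) = \<zero>\<^bsub>K_ring M\<^esub>"
  interpret R: cring ?R by (rule cring_mpoly_ring)
  interpret K: cring "K_ring M" by (rule cring_K_ring)
  interpret I: ideal "K_ideal M" ?R by (rule ideal_K_ideal)
  have h: "?h \<in> ring_hom ?R (K_ring M)"
    unfolding K_ring_def by (rule I.rcos_ring_hom)
  interpret h: ring_hom_cring ?R "K_ring M" ?h
    by (intro ring_hom_cring.intro ring_hom_cring_axioms.intro R.is_cring K.is_cring h)
  have var: "mvar F \<in> carrier ?R" if "fs \<in> flags M" "F \<in> set fs" for fs F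
    using that by (intro mvar_in_carrier) (auto simp: flags_def)
  have x: "?x fs \<in> carrier ?R" and mon: "K_monomial M fs = ?h (?x fs)" if fs: "fs \<in> flags M" for fs
  proof -
    have eq: "(\<Otimes>\<^bsub>?R\<^esub>F\<in>set fs. mvar F) = ?x fs"
      by (rule mpoly_ring_finprod) (use var[OF fs] in auto)
    have "(\<Otimes>\<^bsub>?R\<^esub>F\<in>set fs. mvar F) \<in> carrier ?R"
      using var[OF fs] by (intro R.finprod_closed) auto
    then show "?x fs \<in> carrier ?R" by (simp only: eq)
    have "?h (\<Otimes>\<^bsub>?R\<^esub>F\<in>set fs. mvar F) = (\<Otimes>\<^bsub>K_ring M\<^esub>F\<in>set fs. (?h \<circ> mvar) F)"
      using var[OF fs] by (intro h.hom_finprod) auto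
    then show "K_monomial M fs = ?h (?x fs)"
      unfolding K_monomial_def K_var_def eq by (simp add: comp_def)
  qed
  define z where "z = (\<Sum>fs\<in>flags M. of_int (c fs) * ?x fs)"
  have z_eq: "(\<Oplus>\<^bsub>?R\<^esub>fs\<in>flags M. [c fs] \<cdot>\<^bsub>?R\<^esub> ?x fs) = z"
  proof -
    have "(\<Oplus>\<^bsub>?R\<^esub>fs\<in>flags M. [c fs] \<cdot>\<^bsub>?R\<^esub> ?x fs) = (\<Sum>fs\<in>flags M. [c fs] \<cdot>\<^bsub>?R\<^esub> ?x fs)"
      using x by (intro mpoly_ring_finsum finite_flags[OF fin]) simp
    also have "\<dots> = z" unfolding z_def by (intro sum.cong refl mpoly_ring_int_mult x)
    finally show ?thesis .
  qed
  have z: "z \<in> carrier ?R" unfolding z_eq[symmetric] using x by (intro R.finsum_closed) auto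
  have "?h z = (\<Oplus>\<^bsub>K_ring M\<^esub>fs\<in>flags M. [c fs] \<cdot>\<^bsub>K_ring M\<^esub> ?h (?x fs))"
    unfolding z_eq[symmetric]
    by (rule R.finsum_int_mult_image[symmetric, OF h K.is_cring finite_flags[OF fin] x])
  also have "\<dots> = (\<Oplus>\<^bsub>K_ring M\<^esub>fs\<in>flags M. [c fs] \<cdot>\<^bsub>K_ring M\<^esub> K_monomial M fs)"
    by (intro K.finsum_cong') (auto simp: mon x)
  also have "\<dots> = \<zero>\<^bsub>K_ring M\<^esub>" by (rule zero)
  also have "\<dots> = K_ideal M" unfolding K_ring_def by (simp add: FactRing_def)
  finally have "z \<in> K_ideal M" using z by (intro I.rcos_const_imp_mem)
  moreover have "K_ideal M \<subseteq> {p \<in> carrier ?R. \<forall>m. act f m p = 0}"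
    unfolding K_ideal_def
    using rel K_relations_subset by (intro R.genideal_minimal ideal_annihilator) auto
  ultimately have "act f (\<lambda>_. 0) z = 0" by auto
  then show "(\<Sum>fs\<in>flags M. of_int (c fs) * g fs) = 0"
    unfolding z_def act_sum act_int_mult by (simp add: g cong: sum.cong)
qed

section \<open>The weight of a loopless matroid\<close>

context matroid
begin

lemma grothendieck_weight_gD:
  assumes "loopless M" "ground M \<noteq> {}"
  shows "grothendieck_weight M (gD M)"
proof -
  let ?E = "ground M"
  obtain f where f: "\<And>F G. F \<in> flats M \<Longrightarrow> G \<in> flats M \<Longrightarrow> F \<subset> G \<Longrightarrow> compatible f F G (f F G)"
    using compatible_family_exists by blast
  have E: "?E \<in> flats M" by (simp add: flats_def)
  \<comment> \<open>Looplessness enters here: it makes the empty set a flat, so that the interval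
    from \<open>{}\<close> to the ground set is available.\<close>
  have empty: "{} \<in> flats M"
  proof -
    have "basis_of M {} {}" using empty_indep by (simp add: basis_of_def)
    then show ?thesis using assms(1) flats_iff_basis[of "{}" "{}"] by (simp add: loopless_def)
  qed
  have lt: "{} \<subset> ?E" using assms(2) by auto
  let ?h = "f {} ?E"
  note h = f[OF empty E lt]
  have proper: "open_interval {} ?E = proper_flats M"
    using flat_subset_ground by (auto simp: open_interval_def proper_flats_def)
  have finP: "finite (proper_flats M)"
    using finite_L by (simp add: proper_flats_def)
  show ?thesis
  proof (rule grothendieck_weightI[where f = ?h])
    show "finite ?E" by (rule finite_ground)
  next
    fix p m assume "p \<in> K_relations M"
    then consider (incomp) F G where "p = mvar F * mvar G" "F \<in> proper_flats M" "G \<in> proper_flats M"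
        "\<not> F \<subseteq> G" "\<not> G \<subseteq> F"
      | (linear) i j where "i \<in> ?E" "j \<in> ?E" "p = (\<Prod>F\<in>{F \<in> proper_flats M. i \<notin> F}. 1 - mvar F) -
          (\<Prod>F\<in>{F \<in> proper_flats M. j \<notin> F}. 1 - mvar F)"
      unfolding K_relations_def by blast
    then show "act ?h m p = 0"
    proof cases
      case incomp
      have F: "F \<in> flats M" "{} \<subset> F" "F \<subset> ?E"
        using incomp(2) by (auto simp: proper[symmetric] open_interval_def)
      obtain i j where ij: "i \<in> F - {}" "j \<in> ?E - F" using F by blast
      have dF: "step_diff F ?h m = qvar1 * f {} F (\<lambda>K. m K - m F * contain i K) *
          f F ?E (\<lambda>K. m K - m F * avoid j K)" for m
        using incomp(2) by (intro compatible_diff[OF h _ ij]) (simp add: proper)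
      \<comment> \<open>\<open>G\<close> belongs to neither the interval below \<open>F\<close> nor
        the one above it, so neither factor of the difference at \<open>F\<close> sees its
        exponent.\<close>
      have "step_diff F ?h (m(G := m G + 1)) = step_diff F ?h m"
      proof -
        have "(m(G := m G + 1)) F = m F" using incomp by auto
        moreover have "f {} F (\<lambda>K. (m(G := m G + 1)) K - m F * contain i K) = f {} F (\<lambda>K. m K - m F * contain i K)"
          using incomp(5)
          by (intro depends_onD[OF compatible_depends[OF f[OF empty F(1,2)]]]) (auto simp: open_interval_def)
        moreover have "f F ?E (\<lambda>K. (m(G := m G + 1)) K - m F * avoid j K) = f F ?E (\<lambda>K. m K - m F * avoid j K)"
          using incomp(4)
          by (intro depends_onD[OF compatible_depends[OF f[OF F(1) E F(3)]]]) (auto simp: open_interval_def)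
        ultimately show ?thesis unfolding dF by (simp only:)
      qed
      then have "step_diff G (step_diff F ?h) m = 0" by (simp only: step_diff_def[of G] diff_self)
      moreover have "act ?h m p = step_diff G (step_diff F ?h) m"
        using act_mvar_mult[of "step_diff F ?h" m G 1] by (simp add: incomp(1) act_mvar_mult act_one)
      ultimately show ?thesis by simp
    next
      case linear
      \<comment> \<open>The product shifts only the exponents of proper flats, whereas
        \<open>avoid e\<close> is also 1 at other sets; \<open>?h\<close> does not see the
        difference.\<close>
      have eq: "act ?h m (\<Prod>F\<in>{F \<in> proper_flats M. e \<notin> F}. 1 - mvar F) = ?h (\<lambda>K. m K + avoid e K)" for e
        using finP by (subst act_prod_one_minus_mvar)
          (auto simp: proper avoid_def intro!: depends_onD[OF compatible_depends[OF h]])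
      have "?h (\<lambda>K. m K + 1 * avoid i K) = ?h (\<lambda>K. m K + 1 * avoid j K)"
        using linear by (intro compatible_shift[OF h]) auto
      then show ?thesis by (simp add: linear(3) act_diff eq)
    qed
  next
    fix fs assume fs: "fs \<in> flags M"
    have sorted: "sorted_wrt (\<subset>) ({} # fs @ [?E])" and sub: "set ({} # fs @ [?E]) \<subseteq> flats M"
      using fs lt empty E flat_subset_ground
      by (auto simp: flags_def proper_flats_def sorted_wrt_append)
    have "qvar1 * act ?h (\<lambda>_. 0) (\<Prod>F\<in>set fs. mvar F) = prod_list (map2 chi ({} # fs) (fs @ [?E]))"
      by (rule act_flag[OF f sorted sub])
    also have "\<dots> = pcompose (char_poly_flag M fs) qvar"
      unfolding char_poly_flag_def by (rule pcompose_flag[OF sorted sub, symmetric])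
    also have "\<dots> = qvar1 * gD M fs"
      using gD_times[OF matroid_axioms assms(2) fs] by (simp only: mult.commute)
    finally show "act ?h (\<lambda>_. 0) (\<Prod>F\<in>set fs. mvar F) = gD M fs"
      by (simp del: mult_pCons_left add: mult_cancel_left)
  qed
qed

end

theorem theorem1p6:
  fixes n :: nat and M :: "nat set_system"
  assumes "n \<ge> 1" and "matroid M" and "ground M = {1..n}" and "loopless M"
  shows "grothendieck_weight M (gD M)"
  using assms by (intro matroid.grothendieck_weight_gD) auto

end
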